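(* Let $(\Omega,\mathcal{F},(\mathcal{F}_t)_{t\in[0,T]},\mathbb{P})$ be a filtered probability space, with $\mathcal{M}=\mathcal{A}$ (adapted $\sigma$-algebra) if the filtration satisfies the usual conditions and $\mathcal{M}=\mathrm{Prog}$ (progressive $\sigma$-algebra) otherwise. Let $(\mathbb{Y},d)$ be a nonempty metric space and let $\mathcal{F}_L(\mathbb{Y})$ be the set of bounded real-valued Lipschitz functions on $\mathbb{Y}$ with Lipschitz constant at most $L>0$, equipped with the metric induced by the full Lipschitz norm $$\|f\|_{\mathrm{Lip}}:=\sup_{y\in\mathbb{Y}}|f(y)|+\sup_{y\ne z}\frac{|f(y)-f(z)|}{d(y,z)}.$$ Suppose $G\colon\Omega\times[0,T]\times\mathbb{Y}\to\mathbb{R}$ is uniformly bounded, $G(\cdot,\cdot,y)$ is $\mathcal{M}$-measurable for every $y\in\mathbb{Y}$, and its sections $G(\omega,t,\cdot)$ belong to $\mathcal{F}_L(\mathbb{Y})$ outside a common $\mathcal{M}$-measurable $\mathbb{P}\otimes\lambda$-null set. Set $G=0$ on that set and assume that $\widetilde G(\omega,t)=G(\omega,t,\cdot)$ satisfies either: (a) $\widetilde G$ is $\mathcal{M}/\mathcal{B}_{\mathcal{F}_L(\mathbb{Y})}$-measurable and $\operatorname{dens}(\mathcal{F}_L(\mathbb{Y}))$ is strictly smaller than every real-valued measurable cardinal; or (b) $\widetilde G$ has essentially separable range in $\|\cdot\|_{\mathrm{Lip}}$ (with respect to $\mathbb{P}\otimes\lambda$). Then, for every $1\le p<\infty$ and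 $\varepsilon>0$, there is an elementary function-valued process $\bar G$ with deterministic values in $\mathcal{F}_L(\mathbb{Y})$ such that $$\left(\mathbb{E}\int_0^T\|\bar G(\omega,t,\cdot)-G(\omega,t,\cdot)\|_{\mathrm{Lip}}^p\,dt\right)^{1/p}\le\varepsilon.$$ If, in addition, $Q_t\colon\mathbb{Y}\to\mathbb{Y}$, $t\in[0,T]$, are nonexpansive projections with $t\mapsto Q_ty$ continuous for every $y\in\mathbb{Y}$, and $G(\omega,t,\cdot)\circ Q_t=G(\omega,t,\cdot)$ outside a common $\mathcal{M}$-measurable null set, then $$\widehat G(\omega,t,\cdot):=\bar G(\omega,t,\cdot)\circ Q_t$$ is invariant under $Q_t$ (that is, $\widehat G(\omega,t,\cdot)\circ Q_t=\widehat G(\omega,t,\cdot)$), is progressively measurable for each fixed $y\in\mathbb{Y}$, and satisfies the same $L^p$ error bound in the full Lipschitz norm, that is, $\bigl(\mathbb{E}\int_0^T\|\widehat G(\omega,t,\cdot)-G(\omega,t,\cdot)\|_{\mathrm{Lip}}^p\,dt\bigr)^{1/p}\le\varepsilon$. The stopped error norm $(\omega,t)\mapsto\|\widehat G(\omega,t,\cdot)-G(\omega,t,\cdot)\|_{\mathrm{Lip}}$ is measurable for the completed product measure; $\widehat G$ need not be elementary as a function-valued process.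
   Context: $\lambda$ is Lebesgue measure on $[0,T]$. In $\|\cdot\|_{\mathrm{Lip}}$ the second supremum is zero if $\mathbb{Y}$ has only one point. $\mathcal{B}_{\mathcal{F}_L(\mathbb{Y})}$ is the Borel $\sigma$-algebra of $\mathcal{F}_L(\mathbb{Y})$ for the metric induced by $\|\cdot\|_{\mathrm{Lip}}$. Integrals involving strongly measurable maps (almost everywhere limits of finitely-valued measurable maps) are taken with respect to the completed measure. Nonexpansive projections are $1$-Lipschitz maps with $Q_t\circ Q_t=Q_t$. A filtration satisfies the usual conditions if it is right-continuous and $\mathcal{F}_0$ contains all $\mathbb{P}$-null sets of $\mathcal{F}$. On $[0,T]\times\Omega$ (identified with $\Omega\times[0,T]$): $\mathcal{A}:=\{A\in\mathcal{B}([0,T])\otimes\mathcal{F}: \{\omega:(t,\omega)\in A\}\in\mathcal{F}_t\ \forall t\in[0,T]\}$, and $\mathrm{Prog}:=\{A\in\mathcal{B}([0,T])\otimes\mathcal{F}: A\cap([0,t]\times\Omega)\in\mathcal{B}([0,t])\otimes\mathcal{F}_t\ \forall t\in[0,T]\}$. Progressively measurable means $\mathrm{Prog}$-measurable. An elementary function-valued process with deterministic values in $\mathcal{F}_L(\mathbb{Y})$ is a process of the form $\bar G(\omega,t,\cdot)=\mathbf{1}_{\{0\}}(t)\Xi_0(\omega)+\sum_{i=0}^{n-1}\mathbf{1}_{(t_i,t_{i+1}]}(t)\Xi_i(\omega)$, where $0=t_0<\dots<t_n=T$ and $\Xi_i=\sum_{j=1}^N h_{i,j}\mathbf{1}_{A_{i,j}}$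 with $h_{i,j}\in\mathcal{F}_L(\mathbb{Y})$ and $A_{i,1},\dots,A_{i,N}\in\mathcal{F}_{t_i}$ a partition of $\Omega$ (allowing empty cells). Essentially separable range: there is an $\mathcal{M}$-measurable null set $N$ such that the image of the complement of $N$ is contained in a separable subset of the target. The density $\operatorname{dens}$ of a metric space is the smallest cardinality of a dense subset. A cardinal $\kappa$ is real-valued measurable if there exist a set $I$ of cardinality $\kappa$ and a countably additive probability measure $\pi$ on all subsets of $I$ such that $\pi(\{x\})=0$ for every $x\in I$ and the union of fewer than $\kappa$ subsets of $\pi$-measure zero has $\pi$-measure zero. *)

theory Defs
  imports "HOL-Probability.Probability"
begin

unbundle cardinal_syntax

definition lip_seminorm :: "('y::metric_space \<Rightarrow> real) \<Rightarrow> real" where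
  "lip_seminorm f =
     (if \<forall>y z::'y. y = z then 0
      else (SUP (y, z)\<in>{(y, z). y \<noteq> z}. \<bar>f y - f z\<bar> / dist y z))"

definition lip_norm :: "('y::metric_space \<Rightarrow> real) \<Rightarrow> real" where
  "lip_norm f = (SUP y. \<bar>f y\<bar>) + lip_seminorm f"

definition FL :: "real \<Rightarrow> ('y::metric_space \<Rightarrow> real) set" where
  "FL L = {f. bounded (range f) \<and> L-lipschitz_on UNIV f}"

text \<open>
  The type \<^typ>\<open>'a metric\<close> wants a distance that is nonnegative on the whole type, whereas
  \<^const>\<open>lip_norm\<close> is meaningless for functions that are not bounded and Lipschitz; the
  distance is therefore cut off outside the carrier.
\<close>
definition FL_dist ::
  "real \<Rightarrow> ('y::metric_space \<Rightarrow> real) \<Rightarrow> ('y \<Rightarrow> real) \<Rightarrow> real" where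
  "FL_dist L f g = (if f \<in> FL L \<and> g \<in> FL L then lip_norm (\<lambda>y. f y - g y) else 0)"

definition FL_metric :: "real \<Rightarrow> ('y::metric_space \<Rightarrow> real) metric" where
  "FL_metric L = metric (FL L, FL_dist L)"

definition FL_borel :: "real \<Rightarrow> ('y::metric_space \<Rightarrow> real) measure" where
  "FL_borel L = sigma (FL L) {U. openin (mtopology_of (FL_metric L)) U}"

definition bounded_lipschitz :: "('y::metric_space \<Rightarrow> real) \<Rightarrow> bool" where
  "bounded_lipschitz f \<longleftrightarrow> bounded (range f) \<and> (\<exists>C. C-lipschitz_on UNIV f)"

lemma bounded_lipschitz_FL: "f \<in> FL L \<Longrightarrow> bounded_lipschitz f"
  by (auto simp: FL_def bounded_lipschitz_def)

lemma bounded_lipschitz_diff: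
  assumes "bounded_lipschitz f" "bounded_lipschitz g"
  shows "bounded_lipschitz (\<lambda>y. f y - g y)"
proof -
  obtain C D where "C-lipschitz_on UNIV f" "D-lipschitz_on UNIV g"
    using assms by (auto simp: bounded_lipschitz_def)
  then have "(C + D)-lipschitz_on UNIV (\<lambda>y. f y - g y)"
    by (rule lipschitz_on_diff)
  moreover have "bounded (range (\<lambda>y. f y - g y))"
    using assms bounded_minus_comp[of f UNIV g] by (auto simp: bounded_lipschitz_def)
  ultimately show ?thesis
    by (auto simp: bounded_lipschitz_def)
qed

lemma bdd_above_lip_sup:
  "bounded_lipschitz f \<Longrightarrow> bdd_above (range (\<lambda>y. \<bar>f y\<bar>))"
  by (auto simp: bounded_lipschitz_def bounded_iff bdd_above_def)

lemma bdd_above_lip_quotient: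
  assumes "bounded_lipschitz f"
  shows "bdd_above ((\<lambda>(y, z). \<bar>f y - f z\<bar> / dist y z) ` {(y, z). y \<noteq> z})"
proof -
  obtain C where C: "C-lipschitz_on UNIV f"
    using assms by (auto simp: bounded_lipschitz_def)
  show ?thesis
    using lipschitz_onD[OF C] by (intro bdd_aboveI[of _ C]) (auto simp: dist_real_def divide_simps)
qed

lemma lip_sup_upper: "bounded_lipschitz f \<Longrightarrow> \<bar>f y\<bar> \<le> (SUP y. \<bar>f y\<bar>)"
  by (intro cSUP_upper bdd_above_lip_sup) auto

lemma lip_seminorm_upper:
  assumes "bounded_lipschitz f" "y \<noteq> z"
  shows "\<bar>f y - f z\<bar> / dist y z \<le> lip_seminorm f"
  using cSUP_upper[OF _ bdd_above_lip_quotient[OF assms(1)], of "(y, z)"] assms(2)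
  by (auto simp: lip_seminorm_def)

lemma lip_seminorm_least:
  assumes "0 \<le> c" "\<And>y z. y \<noteq> z \<Longrightarrow> \<bar>f y - f z\<bar> / dist y z \<le> c"
  shows "lip_seminorm f \<le> c"
  using assms unfolding lip_seminorm_def by (auto intro!: cSUP_least)

lemma lip_seminorm_nonneg: "bounded_lipschitz f \<Longrightarrow> 0 \<le> lip_seminorm f"
proof (cases "\<forall>y z::'a. y = z")
  case False
  assume f: "bounded_lipschitz f"
  from False obtain y z :: 'a where yz: "y \<noteq> z" by blast
  have "0 \<le> \<bar>f y - f z\<bar> / dist y z" by simp
  also note lip_seminorm_upper[OF f yz]
  finally show ?thesis .
qed (simp add: lip_seminorm_def)

lemma lip_sup_nonneg: "bounded_lipschitz f \<Longrightarrow> 0 \<le> (SUP y. \<bar>f y\<bar>)"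
  using lip_sup_upper[of f] abs_ge_zero order_trans by blast

lemma lip_norm_nonneg: "bounded_lipschitz f \<Longrightarrow> 0 \<le> lip_norm f"
  by (simp add: lip_norm_def lip_seminorm_nonneg lip_sup_nonneg)

lemma lip_norm_eq_0_iff:
  assumes "bounded_lipschitz f"
  shows "lip_norm f = 0 \<longleftrightarrow> f = (\<lambda>_. 0)"
proof
  assume "lip_norm f = 0"
  then have "(SUP y. \<bar>f y\<bar>) \<le> 0"
    using lip_seminorm_nonneg[OF assms] by (simp add: lip_norm_def)
  then have "\<bar>f y\<bar> \<le> 0" for y
    using lip_sup_upper[OF assms, of y] by linarith
  then show "f = (\<lambda>_. 0)" by auto
next
  assume f: "f = (\<lambda>_. 0)"
  have "lip_seminorm f \<le> 0"
    by (rule lip_seminorm_least) (auto simp: f)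
  then show "lip_norm f = 0"
    using lip_seminorm_nonneg[OF assms] by (simp add: lip_norm_def f)
qed

lemma lip_norm_add:
  assumes "bounded_lipschitz f" "bounded_lipschitz g" "bounded_lipschitz (\<lambda>y. f y + g y)"
  shows "lip_norm (\<lambda>y. f y + g y) \<le> lip_norm f + lip_norm g"
proof -
  have "(SUP y. \<bar>f y + g y\<bar>) \<le> (SUP y. \<bar>f y\<bar>) + (SUP y. \<bar>g y\<bar>)"
  proof (rule cSUP_least)
    fix y
    show "\<bar>f y + g y\<bar> \<le> (SUP y. \<bar>f y\<bar>) + (SUP y. \<bar>g y\<bar>)"
      using lip_sup_upper[OF assms(1), of y] lip_sup_upper[OF assms(2), of y] by linarith
  qed simp
  moreover have "lip_seminorm (\<lambda>y. f y + g y) \<le> lip_seminorm f + lip_seminorm g"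
  proof (rule lip_seminorm_least)
    show "0 \<le> lip_seminorm f + lip_seminorm g"
      using assms by (simp add: lip_seminorm_nonneg)
    fix y z :: 'a assume "y \<noteq> z"
    have "\<bar>f y + g y - (f z + g z)\<bar> / dist y z \<le> (\<bar>f y - f z\<bar> + \<bar>g y - g z\<bar>) / dist y z"
      by (intro divide_right_mono) auto
    also have "\<dots> = \<bar>f y - f z\<bar> / dist y z + \<bar>g y - g z\<bar> / dist y z"
      by (rule add_divide_distrib)
    also have "\<dots> \<le> lip_seminorm f + lip_seminorm g"
      by (intro add_mono lip_seminorm_upper assms \<open>y \<noteq> z\<close>)
    finally show "\<bar>f y + g y - (f z + g z)\<bar> / dist y z \<le> lip_seminorm f + lip_seminorm g" .
  qed
  ultimately show ?thesis by (simp add: lip_norm_def)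
qed

lemma lip_norm_minus_commute: "lip_norm (\<lambda>y. f y - g y) = lip_norm (\<lambda>y. g y - f y)"
proof -
  have "\<bar>f y - g y - (f z - g z)\<bar> = \<bar>g y - f y - (g z - f z)\<bar>" for y z
    by linarith
  then have "lip_seminorm (\<lambda>y. f y - g y) = lip_seminorm (\<lambda>y. g y - f y)"
    unfolding lip_seminorm_def by presburger
  then show ?thesis
    by (simp add: lip_norm_def abs_minus_commute)
qed

lemma Metric_space_FL: "Metric_space (FL L) (FL_dist L)"
proof
  fix f g h :: "'a \<Rightarrow> real"
  show "0 \<le> FL_dist L f g"
    using lip_norm_nonneg[OF bounded_lipschitz_diff] bounded_lipschitz_FL
    by (auto simp: FL_dist_def)
  show "FL_dist L f g = FL_dist L g f"
    using lip_norm_minus_commute[of f g] by (auto simp: FL_dist_def)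
  assume fg: "f \<in> FL L" "g \<in> FL L"
  then have fg': "bounded_lipschitz (\<lambda>y. f y - g y)"
    by (intro bounded_lipschitz_diff bounded_lipschitz_FL[where L = L])
  show "FL_dist L f g = 0 \<longleftrightarrow> f = g"
    using fg lip_norm_eq_0_iff[OF fg'] by (auto simp: FL_dist_def fun_eq_iff)
  assume h: "h \<in> FL L"
  have gh': "bounded_lipschitz (\<lambda>y. g y - h y)"
    using fg h by (intro bounded_lipschitz_diff bounded_lipschitz_FL[where L = L])
  have fh': "bounded_lipschitz (\<lambda>y. f y - h y)"
    using fg h by (intro bounded_lipschitz_diff bounded_lipschitz_FL[where L = L])
  show "FL_dist L f h \<le> FL_dist L f g + FL_dist L g h"
    using lip_norm_add[OF fg' gh'] fh' fg h by (simp add: FL_dist_def)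
qed

lemma mspace_FL_metric [simp]: "mspace (FL_metric L) = FL L"
  by (simp add: FL_metric_def Metric_space.mspace_metric[OF Metric_space_FL])

lemma mdist_FL_metric [simp]: "mdist (FL_metric L) = FL_dist L"
  by (simp add: FL_metric_def Metric_space.mdist_metric[OF Metric_space_FL])

definition dense_in :: "'a topology \<Rightarrow> 'a set \<Rightarrow> bool" where
  "dense_in X D \<longleftrightarrow> D \<subseteq> topspace X \<and> X closure_of D = topspace X"

definition dens :: "'a topology \<Rightarrow> 'a rel" where
  "dens X = (SOME \<kappa>. (\<exists>D. dense_in X D \<and> \<kappa> = card_of D) \<and> (\<forall>D. dense_in X D \<longrightarrow> \<kappa> \<le>o card_of D))"

lemma dens_properties:
  "(\<exists>D. dense_in X D \<and> dens X = card_of D) \<and> (\<forall>D. dense_in X D \<longrightarrow> dens X \<le>o card_of D)"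
  unfolding dens_def
proof (rule someI_ex)
  let ?R = "card_of ` {D. dense_in X D}"
  have "dense_in X (topspace X)"
    by (simp add: dense_in_def)
  then have "?R \<noteq> {}" by blast
  moreover have "\<forall>r\<in>?R. Card_order r"
    using card_of_Card_order by blast
  ultimately show "\<exists>\<kappa>. (\<exists>D. dense_in X D \<and> \<kappa> = card_of D) \<and> (\<forall>D. dense_in X D \<longrightarrow> \<kappa> \<le>o card_of D)"
    using exists_minim_Card_order[of ?R] by blast
qed

definition real_valued_measurable :: "'i rel \<Rightarrow> bool" where
  "real_valued_measurable \<kappa> \<longleftrightarrow> Card_order \<kappa> \<and>
     (\<exists>(I::'i set) \<pi>. card_of I =o \<kappa> \<and> prob_space \<pi> \<and> space \<pi> = I \<and> sets \<pi> = Pow I \<and>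
        (\<forall>x\<in>I. emeasure \<pi> {x} = 0) \<and>
        (\<forall>\<N>\<subseteq>Pow I. card_of \<N> <o \<kappa> \<and> (\<forall>N\<in>\<N>. emeasure \<pi> N = 0) \<longrightarrow> emeasure \<pi> (\<Union>\<N>) = 0))"

text \<open>
  Letting \<open>\<kappa>\<close> range only over the cardinals realised in the type \<^typ>\<open>'a\<close> loses nothing: the
  density is at most the cardinality of that type, and every cardinal that cannot be realised in it
  is strictly larger.
\<close>
definition dens_below_real_valued_measurable :: "'a topology \<Rightarrow> bool" where
  "dens_below_real_valued_measurable X \<longleftrightarrow>
     (\<forall>\<kappa>::'a rel. real_valued_measurable \<kappa> \<longrightarrow> dens X <o \<kappa>)"

text \<open>Only the sigma-algebra of each \<open>F t\<close> matters, and only for \<open>t\<close> in \<open>[0, T]\<close>.\<close>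
locale filtered_prob_space = prob_space M
  for M :: "'a measure" and F :: "real \<Rightarrow> 'a measure" and T :: real +
  assumes subalgebra_F: "t \<in> {0..T} \<Longrightarrow> subalgebra M (F t)"
    and F_mono: "s \<in> {0..T} \<Longrightarrow> t \<in> {0..T} \<Longrightarrow> s \<le> t \<Longrightarrow> sets (F s) \<subseteq> sets (F t)"

definition usual_conditions :: "'a measure \<Rightarrow> (real \<Rightarrow> 'a measure) \<Rightarrow> real \<Rightarrow> bool" where
  "usual_conditions M F T \<longleftrightarrow>
     (\<forall>t\<in>{0..<T}. sets (F t) = (\<Inter>s\<in>{t<..T}. sets (F s))) \<and> null_sets M \<subseteq> sets (F 0)"

abbreviation time_prod :: "'a measure \<Rightarrow> real \<Rightarrow> ('a \<times> real) measure" where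
  "time_prod M T \<equiv> M \<Otimes>\<^sub>M restrict_space lborel {0..T}"

text \<open>
  The collections below are already sigma-algebras on \<open>\<Omega> \<times> [0, T]\<close>, see \<open>sets_adapted_sigma\<close>
  and \<open>sets_prog_sigma\<close>; \<^const>\<open>sigma\<close> only turns them into measurable spaces.
\<close>
definition adapted_sigma :: "'a measure \<Rightarrow> (real \<Rightarrow> 'a measure) \<Rightarrow> real \<Rightarrow> ('a \<times> real) measure" where
  "adapted_sigma M F T = sigma (space M \<times> {0..T})
     {A \<in> sets (time_prod M T). \<forall>t\<in>{0..T}. {\<omega>. (\<omega>, t) \<in> A} \<in> sets (F t)}"

definition prog_sigma :: "'a measure \<Rightarrow> (real \<Rightarrow> 'a measure) \<Rightarrow> real \<Rightarrow> ('a \<times> real) measure" where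
  "prog_sigma M F T = sigma (space M \<times> {0..T})
     {A \<in> sets (time_prod M T). \<forall>t\<in>{0..T}.
        A \<inter> (space M \<times> {0..t}) \<in> sets (F t \<Otimes>\<^sub>M restrict_space borel {0..t})}"

definition process_sigma :: "'a measure \<Rightarrow> (real \<Rightarrow> 'a measure) \<Rightarrow> real \<Rightarrow> ('a \<times> real) measure" where
  "process_sigma M F T = (if usual_conditions M F T then adapted_sigma M F T else prog_sigma M F T)"

lemma space_time_prod: "space (time_prod M T) = space M \<times> {0..T}"
  by (simp add: space_pair_measure space_restrict_space)

context filtered_prob_space
begin

lemma space_F: "t \<in> {0..T} \<Longrightarrow> space (F t) = space M"
  using subalgebra_F by (simp add: subalgebra_def)

lemma sets_adapted_sigma:
  "sets (adapted_sigma M F T) =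
     {A \<in> sets (time_prod M T). \<forall>t\<in>{0..T}. {\<omega>. (\<omega>, t) \<in> A} \<in> sets (F t)}" (is "_ = ?S")
proof -
  have "sigma_algebra (space M \<times> {0..T}) ?S"
    unfolding sigma_algebra_iff2
  proof (intro conjI ballI allI impI)
    show "?S \<subseteq> Pow (space M \<times> {0..T})"
      using sets.sets_into_space[of _ "time_prod M T"] by (auto simp: space_time_prod)
    show "{} \<in> ?S" by simp
  next
    fix A assume A: "A \<in> ?S"
    have "space M \<times> {0..T} - A \<in> sets (time_prod M T)"
      using A sets.compl_sets[of A "time_prod M T"] by (simp add: space_time_prod)
    moreover have "{\<omega>. (\<omega>, t) \<in> space M \<times> {0..T} - A} \<in> sets (F t)" if t: "t \<in> {0..T}" for t
    proof -
      have "{\<omega>. (\<omega>, t) \<in> space M \<times> {0..T} - A} = space (F t) - {\<omega>. (\<omega>, t) \<in> A}"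
        using t by (auto simp: space_F)
      then show ?thesis using A t by auto
    qed
    ultimately show "space M \<times> {0..T} - A \<in> ?S" by simp
  next
    fix A :: "nat \<Rightarrow> _" assume A: "range A \<subseteq> ?S"
    have "{\<omega>. (\<omega>, t) \<in> \<Union> (range A)} \<in> sets (F t)" if t: "t \<in> {0..T}" for t
    proof -
      have "{\<omega>. (\<omega>, t) \<in> \<Union> (range A)} = (\<Union>i. {\<omega>. (\<omega>, t) \<in> A i})" by auto
      moreover have "{\<omega>. (\<omega>, t) \<in> A i} \<in> sets (F t)" for i
        using A t by blast
      ultimately show ?thesis by auto
    qed
    then show "\<Union> (range A) \<in> ?S" using A by auto
  qed
  then show ?thesis
    unfolding adapted_sigma_def by (intro sigma_algebra.sets_measure_of_eq)
qed

lemma sets_prog_sigma: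
  "sets (prog_sigma M F T) =
     {A \<in> sets (time_prod M T). \<forall>t\<in>{0..T}.
        A \<inter> (space M \<times> {0..t}) \<in> sets (F t \<Otimes>\<^sub>M restrict_space borel {0..t})}" (is "_ = ?S")
proof -
  have "sigma_algebra (space M \<times> {0..T}) ?S"
    unfolding sigma_algebra_iff2
  proof (intro conjI ballI allI impI)
    show "?S \<subseteq> Pow (space M \<times> {0..T})"
      using sets.sets_into_space[of _ "time_prod M T"] by (auto simp: space_time_prod)
    show "{} \<in> ?S" by simp
  next
    fix A assume A: "A \<in> ?S"
    have "space M \<times> {0..T} - A \<in> sets (time_prod M T)"
      using A sets.compl_sets[of A "time_prod M T"] by (simp add: space_time_prod)
    moreover have "(space M \<times> {0..T} - A) \<inter> (space M \<times> {0..t})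
        \<in> sets (F t \<Otimes>\<^sub>M restrict_space borel {0..t})" if t: "t \<in> {0..T}" for t
    proof -
      have "(space M \<times> {0..T} - A) \<inter> (space M \<times> {0..t}) =
          space (F t \<Otimes>\<^sub>M restrict_space borel {0..t}) - A \<inter> (space M \<times> {0..t})"
        using t by (auto simp: space_F space_pair_measure space_restrict_space)
      then show ?thesis using A t by auto
    qed
    ultimately show "space M \<times> {0..T} - A \<in> ?S" by simp
  next
    fix A :: "nat \<Rightarrow> _" assume A: "range A \<subseteq> ?S"
    have "\<Union> (range A) \<inter> (space M \<times> {0..t}) \<in> sets (F t \<Otimes>\<^sub>M restrict_space borel {0..t})"
      if t: "t \<in> {0..T}" for t
    proof -
      have "A i \<inter> (space M \<times> {0..t}) \<in> sets (F t \<Otimes>\<^sub>M restrict_space borel {0..t})" for i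
        using A t by blast
      then have "(\<Union>i. A i \<inter> (space M \<times> {0..t})) \<in> sets (F t \<Otimes>\<^sub>M restrict_space borel {0..t})"
        by (intro sets.countable_UN) blast
      then show ?thesis by (simp only: Int_UN_distrib2 UN_extend_simps)
    qed
    then show "\<Union> (range A) \<in> ?S" using A by auto
  qed
  then show ?thesis
    unfolding prog_sigma_def by (intro sigma_algebra.sets_measure_of_eq)
qed

end

definition process_null_sets ::
  "'a measure \<Rightarrow> (real \<Rightarrow> 'a measure) \<Rightarrow> real \<Rightarrow> ('a \<times> real) set set" where
  "process_null_sets M F T = sets (process_sigma M F T) \<inter> null_sets (time_prod M T)"

definition zero_on ::
  "('a \<times> real) set \<Rightarrow> ('a \<Rightarrow> real \<Rightarrow> 'y \<Rightarrow> real) \<Rightarrow> 'a \<Rightarrow> real \<Rightarrow> 'y \<Rightarrow> real" where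
  "zero_on N G = (\<lambda>\<omega> t. if (\<omega>, t) \<in> N then (\<lambda>_. 0) else G \<omega> t)"

definition essentially_separable_range ::
  "'a measure \<Rightarrow> (real \<Rightarrow> 'a measure) \<Rightarrow> real \<Rightarrow> real \<Rightarrow>
    ('a \<Rightarrow> real \<Rightarrow> 'y::metric_space \<Rightarrow> real) \<Rightarrow> bool" where
  "essentially_separable_range M F T L G \<longleftrightarrow>
     (\<exists>N\<in>process_null_sets M F T. \<exists>S\<subseteq>FL L.
        separable_space (subtopology (mtopology_of (FL_metric L)) S) \<and>
        (\<forall>(\<omega>, t)\<in>space M \<times> {0..T} - N. G \<omega> t \<in> S))"

definition elementary_process ::
  "'a measure \<Rightarrow> (real \<Rightarrow> 'a measure) \<Rightarrow> real \<Rightarrow> real \<Rightarrow>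
    ('a \<Rightarrow> real \<Rightarrow> 'y::metric_space \<Rightarrow> real) \<Rightarrow> bool" where
  "elementary_process M F T L H \<longleftrightarrow>
     (\<exists>(n::nat) (m::nat) (t::nat \<Rightarrow> real) (h::nat \<Rightarrow> nat \<Rightarrow> 'y \<Rightarrow> real) (A::nat \<Rightarrow> nat \<Rightarrow> 'a set).
        let \<Xi> = (\<lambda>i \<omega> y. \<Sum>j<m. h i j y * indicator (A i j) \<omega>) in
        0 < n \<and> t 0 = 0 \<and> t n = T \<and> (\<forall>i<n. t i < t (Suc i)) \<and>
        (\<forall>i<n. (\<forall>j<m. h i j \<in> FL L \<and> A i j \<in> sets (F (t i))) \<and>
               disjoint_family_on (A i) {..<m} \<and> (\<Union>j<m. A i j) = space M) \<and>
        (\<forall>\<omega>\<in>space M. \<forall>s\<in>{0..T}. \<forall>y.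
           H \<omega> s y = indicator {0} s * \<Xi> 0 \<omega> y +
             (\<Sum>i<n. indicator {t i<..t (Suc i)} s * \<Xi> i \<omega> y)))"

text \<open>
  Integrability is part of the error bound, because the Bochner integral of a function that is not
  integrable is \<open>0\<close> by convention.
\<close>
definition Lp_error_le ::
  "'a measure \<Rightarrow> real \<Rightarrow> real \<Rightarrow> ('a \<Rightarrow> real \<Rightarrow> 'y::metric_space \<Rightarrow> real) \<Rightarrow>
    ('a \<Rightarrow> real \<Rightarrow> 'y \<Rightarrow> real) \<Rightarrow> real \<Rightarrow> bool" where
  "Lp_error_le M T p H G \<epsilon> \<longleftrightarrow>
     (let e = (\<lambda>(\<omega>, t). lip_norm (\<lambda>y. H \<omega> t y - G \<omega> t y) powr p) in
      integrable (completion (time_prod M T)) e \<and>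
      (\<integral>x. e x \<partial>completion (time_prod M T)) powr (1 / p) \<le> \<epsilon>)"

definition nonexpansive_projection :: "('y::metric_space \<Rightarrow> 'y) \<Rightarrow> bool" where
  "nonexpansive_projection q \<longleftrightarrow> 1-lipschitz_on UNIV q \<and> q \<circ> q = q"

end

theory Submission
  imports Defs
begin

text \<open>
  The process \<open>G\<close> is replaced, off a set of small measure, by a process with finitely many values
  \<open>d 0, \<dots>, d (K - 1)\<close> in the function space, and that process is then sampled along a grid of times.
  The error norms stay below one constant, so smallness of the exceptional set is smallness in \<open>L\<^sup>p\<close>.

  \<^emph>\<open>Separable range.\<close> Under the cardinality hypothesis the range of \<open>G\<close> is essentially separable, by
  the theorem of Marczewski and Sikorski (\<open>Borel_map_essentially_separable\<close>). The balls of a fixed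
  radius around a dense set \<open>D\<close> of least cardinality are cut down to countably many disjoint families
  of open sets indexed by \<open>D\<close>, as in Stone's theorem. Each family carries a finite measure on all
  subsets of \<open>D\<close>; if it were not concentrated on countably many indices, its diffuse part would
  produce a real-valued measurable cardinal not exceeding the density.

  \<^emph>\<open>Quantization.\<close> On a separable set the Lipschitz norm is a supremum over countably many evaluation
  functionals (\<open>countable_norming_triples\<close>), so the distance of \<open>G\<close> to a fixed function is measurable
  off a null set. Choosing the first function of a dense sequence that is \<open>\<delta>\<close>-close, among the first
  \<open>K\<close> ones, gives the finitely-valued process (\<open>exists_finite_quantization\<close>).

  \<^emph>\<open>Sampling.\<close> Let \<open>g\<close> be the index process. By a Dynkin argument, the measure of the set where
  \<open>g \<omega> t \<noteq> g \<omega> (t + u)\<close> tends to \<open>0\<close> with the lag \<open>u\<close> (\<open>tendsto_measure_shift_change\<close>). For a grid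
  \<open>s, s + h, s + 2 h, \<dots>\<close> with offset \<open>s\<close> uniform in \<open>(0, h)\<close>, the distance from a time \<open>t > h\<close> back to
  the last grid point is uniform in \<open>(0, h)\<close>; hence some offset makes \<open>g\<close> at the last grid point agree
  with \<open>g\<close> at \<open>t\<close> off a set of small measure (\<open>exists_grid_offset\<close>). The sampled process is elementary
  and takes only the values \<open>d k\<close>. Besides joint measurability, sampling uses only that the
  sections of the level sets at time \<open>t\<close> lie in \<open>F t\<close>, so the adapted and the progressive
  sigma-algebras are treated alike.

  \<^emph>\<open>Composition with projections.\<close> Since \<open>G = G \<circ> Q t\<close> almost everywhere and composition with a
  nonexpansive map does not increase the norm, the error of the composed process is at most the
  original one. The norm of a fixed function composed with \<open>Q t\<close> is lower semicontinuous in \<open>t\<close>, and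
  the norm of the error is an infimum of countably many sums of such a function and a measurable one
  (\<open>lip_norm_process_measurable\<close>). The case of the identity map covers the elementary process itself.
\<close>

section \<open>The Lipschitz norm as a single supremum\<close>

text \<open>
  The two suprema of \<^const>\<open>lip_norm\<close> merge into a single one, over all triples of points. The
  conventions \<open>x / 0 = 0\<close> and \<open>dist y y = 0\<close> make the degenerate triples harmless.
\<close>
definition lip_eval :: "'y::metric_space \<times> 'y \<times> 'y \<Rightarrow> ('y \<Rightarrow> real) \<Rightarrow> real" where
  "lip_eval = (\<lambda>(x, y, z) f. \<bar>f x\<bar> + \<bar>f y - f z\<bar> / dist y z)"

lemma lip_eval_nonneg: "0 \<le> lip_eval \<tau> f"
  by (auto simp: lip_eval_def split: prod.split)

lemma lip_eval_le_lip_norm: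
  assumes "bounded_lipschitz f"
  shows "lip_eval \<tau> f \<le> lip_norm f"
proof -
  obtain x y z where \<tau>: "\<tau> = (x, y, z)" by (cases \<tau>) auto
  have "\<bar>f y - f z\<bar> / dist y z \<le> lip_seminorm f"
    using lip_seminorm_upper[OF assms, of y z] lip_seminorm_nonneg[OF assms] by (cases "y = z") auto
  then show ?thesis
    using lip_sup_upper[OF assms, of x] by (simp add: \<tau> lip_eval_def lip_norm_def)
qed

lemma lip_norm_le_iff:
  assumes "bounded_lipschitz f"
  shows "lip_norm f \<le> c \<longleftrightarrow> (\<forall>\<tau>. lip_eval \<tau> f \<le> c)"
proof
  assume "lip_norm f \<le> c"
  then show "\<forall>\<tau>. lip_eval \<tau> f \<le> c"
    using lip_eval_le_lip_norm[OF assms] order_trans by blast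
next
  assume *: "\<forall>\<tau>. lip_eval \<tau> f \<le> c"
  then have le: "\<bar>f x\<bar> + \<bar>f y - f z\<bar> / dist y z \<le> c" for x y z
    by (auto simp: lip_eval_def)
  have sup: "(SUP x. \<bar>f x\<bar>) \<le> c - \<bar>f y - f z\<bar> / dist y z" for y z
    using le[of _ y z] by (intro cSUP_least) (auto simp: algebra_simps)
  have "lip_seminorm f \<le> c - (SUP x. \<bar>f x\<bar>)"
  proof (rule lip_seminorm_least)
    show "0 \<le> c - (SUP x. \<bar>f x\<bar>)"
      using sup[of undefined undefined] by simp
  next
    fix y z :: 'a
    show "\<bar>f y - f z\<bar> / dist y z \<le> c - (SUP x. \<bar>f x\<bar>)"
      using sup[of y z] by simp
  qed
  then show "lip_norm f \<le> c"
    by (simp add: lip_norm_def)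
qed

lemma lip_eval_triangle: "lip_eval \<tau> (\<lambda>y. f y + g y) \<le> lip_eval \<tau> f + lip_eval \<tau> g"
proof -
  obtain x y z where \<tau>: "\<tau> = (x, y, z)" by (cases \<tau>) auto
  have "\<bar>f y + g y - (f z + g z)\<bar> / dist y z \<le> (\<bar>f y - f z\<bar> + \<bar>g y - g z\<bar>) / dist y z"
    by (intro divide_right_mono) auto
  then show ?thesis
    by (auto simp: \<tau> lip_eval_def add_divide_distrib)
qed

lemma bounded_lipschitz_add:
  assumes "bounded_lipschitz f" "bounded_lipschitz g"
  shows "bounded_lipschitz (\<lambda>y. f y + g y)"
proof -
  obtain C D where "C-lipschitz_on UNIV f" "D-lipschitz_on UNIV g"
    using assms by (auto simp: bounded_lipschitz_def)
  then have "(C + D)-lipschitz_on UNIV (\<lambda>y. f y + g y)"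
    by (rule lipschitz_on_add)
  moreover have "bounded (range (\<lambda>y. f y + g y))"
    using assms bounded_plus_comp[of f UNIV g] by (auto simp: bounded_lipschitz_def)
  ultimately show ?thesis
    by (auto simp: bounded_lipschitz_def)
qed

lemma lip_norm_triangle:
  assumes "bounded_lipschitz f" "bounded_lipschitz g"
  shows "lip_norm (\<lambda>y. f y + g y) \<le> lip_norm f + lip_norm g"
  by (intro lip_norm_add assms bounded_lipschitz_add)

lemma lip_norm_diff_triangle:
  assumes "bounded_lipschitz f" "bounded_lipschitz g" "bounded_lipschitz h"
  shows "lip_norm (\<lambda>y. f y - h y) \<le> lip_norm (\<lambda>y. f y - g y) + lip_norm (\<lambda>y. g y - h y)"
  using lip_norm_triangle[OF bounded_lipschitz_diff[OF assms(1,2)] bounded_lipschitz_diff[OF assms(2,3)]]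
  by simp

lemma lip_norm_FL_le:
  assumes "f \<in> FL L" "\<And>y. \<bar>f y\<bar> \<le> C"
  shows "lip_norm f \<le> C + L"
proof -
  have lip: "L-lipschitz_on UNIV f"
    using assms by (auto simp: FL_def)
  have "lip_eval \<tau> f \<le> C + L" for \<tau>
  proof -
    obtain x y z where \<tau>: "\<tau> = (x, y, z)" by (cases \<tau>) auto
    have "\<bar>f y - f z\<bar> / dist y z \<le> L"
      using lipschitz_onD[OF lip, of y z] lipschitz_on_nonneg[OF lip]
      by (cases "y = z") (auto simp: dist_real_def divide_simps)
    then show ?thesis
      using assms(2)[of x] by (simp add: \<tau> lip_eval_def)
  qed
  then show ?thesis
    using lip_norm_le_iff bounded_lipschitz_FL[OF assms(1)] by blast
qed

lemma zero_in_FL: "0 \<le> L \<Longrightarrow> (\<lambda>_. 0) \<in> FL L"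
  by (auto simp: FL_def lipschitz_on_def)

lemma bounded_lipschitz_zero: "bounded_lipschitz (\<lambda>_. 0)"
  using zero_in_FL[of 1] bounded_lipschitz_FL by fastforce

lemma lip_norm_diff_le:
  assumes "bounded_lipschitz f" "bounded_lipschitz g"
  shows "lip_norm (\<lambda>y. f y - g y) \<le> lip_norm f + lip_norm g"
  using lip_norm_diff_triangle[OF assms(1) bounded_lipschitz_zero assms(2)]
    lip_norm_minus_commute[of "\<lambda>_. 0" g] by simp

lemma lip_norm_zero: "lip_norm (\<lambda>_. 0) = 0"
  using zero_in_FL[of 1] bounded_lipschitz_FL lip_norm_eq_0_iff by fastforce

lemma bounded_lipschitz_comp:
  assumes "bounded_lipschitz f" "1-lipschitz_on UNIV q"
  shows "bounded_lipschitz (f \<circ> q)"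
proof -
  obtain C where C: "C-lipschitz_on UNIV f"
    using assms by (auto simp: bounded_lipschitz_def)
  have "(C * 1)-lipschitz_on UNIV (f \<circ> q)"
    by (intro lipschitz_on_compose assms(2) lipschitz_on_subset[OF C]) auto
  moreover have "bounded (range (f \<circ> q))"
    using assms(1) by (auto simp: bounded_lipschitz_def intro: bounded_subset)
  ultimately show ?thesis
    unfolding bounded_lipschitz_def by blast
qed

lemma lip_norm_comp_le:
  assumes "bounded_lipschitz f" "1-lipschitz_on UNIV q"
  shows "lip_norm (f \<circ> q) \<le> lip_norm f"
proof -
  have "lip_eval \<tau> (f \<circ> q) \<le> lip_norm f" for \<tau>
  proof -
    obtain x y z where \<tau>: "\<tau> = (x, y, z)" by (cases \<tau>) auto
    have "\<bar>f (q y) - f (q z)\<bar> / dist y z \<le> \<bar>f (q y) - f (q z)\<bar> / dist (q y) (q z)"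
    proof (cases "q y = q z")
      case False
      have "dist (q y) (q z) \<le> dist y z"
        using lipschitz_onD[OF assms(2), of y z] by simp
      with False show ?thesis
        by (intro divide_left_mono) (auto intro!: mult_pos_pos)
    qed simp
    then have "lip_eval \<tau> (f \<circ> q) \<le> lip_eval (q x, q y, q z) f"
      by (simp add: \<tau> lip_eval_def)
    also have "\<dots> \<le> lip_norm f"
      by (rule lip_eval_le_lip_norm[OF assms(1)])
    finally show ?thesis .
  qed
  then show ?thesis
    using lip_norm_le_iff[OF bounded_lipschitz_comp[OF assms]] by blast
qed

text \<open>
  On a separable family the norm is a supremum over countably many triples. This is what makes the
  norm of a process measurable, although the space of points need not be separable.
\<close>
lemma countable_norming_triples:
  assumes "countable D" and D: "\<And>d. d \<in> D \<Longrightarrow> bounded_lipschitz d"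
  obtains \<Theta> :: "('y::metric_space \<times> 'y \<times> 'y) set" where "countable \<Theta>" "\<Theta> \<noteq> {}"
    "\<And>f c. bounded_lipschitz f \<Longrightarrow>
       (\<And>\<epsilon>. 0 < \<epsilon> \<Longrightarrow> \<exists>d\<in>D. lip_norm (\<lambda>y. f y - d y) < \<epsilon>) \<Longrightarrow>
       (\<And>\<tau>. \<tau> \<in> \<Theta> \<Longrightarrow> lip_eval \<tau> f \<le> c) \<Longrightarrow> lip_norm f \<le> c"
proof -
  have "\<exists>\<tau>. lip_norm d - 1 / real (Suc n) < lip_eval \<tau> d" if "d \<in> D" for d n
    using lip_norm_le_iff[OF D[OF that], of "lip_norm d - 1 / real (Suc n)"] by (auto simp: not_le)
  then obtain t where t: "\<And>d n. d \<in> D \<Longrightarrow> lip_norm d - 1 / real (Suc n) < lip_eval (t d n) d"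
    by metis
  define \<Theta> where "\<Theta> = insert undefined ((\<lambda>(d, n). t d n) ` (D \<times> (UNIV :: nat set)))"
  show ?thesis
  proof (rule that[of \<Theta>])
    show "countable \<Theta>"
      using assms(1) by (auto simp: \<Theta>_def)
    show "\<Theta> \<noteq> {}"
      by (simp add: \<Theta>_def)
    fix f c
    assume f: "bounded_lipschitz f"
      and approx: "\<And>\<epsilon>. 0 < \<epsilon> \<Longrightarrow> \<exists>d\<in>D. lip_norm (\<lambda>y. f y - d y) < \<epsilon>"
      and le: "\<And>\<tau>. \<tau> \<in> \<Theta> \<Longrightarrow> lip_eval \<tau> f \<le> c"
    show "lip_norm f \<le> c"
    proof (rule field_le_epsilon)
      fix e :: real assume "0 < e"
      then obtain d where d: "d \<in> D" "lip_norm (\<lambda>y. f y - d y) < e / 3"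
        using approx[of "e / 3"] by auto
      obtain n where n: "1 / real (Suc n) < e / 3"
        using \<open>0 < e\<close> nat_approx_posE[of "e / 3"] by auto
      let ?\<tau> = "t d n"
      have "lip_norm f \<le> lip_norm (\<lambda>y. f y - d y) + lip_norm d"
        using lip_norm_triangle[OF bounded_lipschitz_diff[OF f D[OF d(1)]] D[OF d(1)]] by simp
      also have "lip_norm d \<le> lip_eval ?\<tau> d + 1 / real (Suc n)"
        using t[OF d(1), of n] by simp
      also have "lip_eval ?\<tau> d \<le> lip_eval ?\<tau> f + lip_eval ?\<tau> (\<lambda>y. d y - f y)"
        using lip_eval_triangle[of ?\<tau> f "\<lambda>y. d y - f y"] by simp
      also have "lip_eval ?\<tau> (\<lambda>y. d y - f y) \<le> lip_norm (\<lambda>y. f y - d y)"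
        using lip_eval_le_lip_norm[OF bounded_lipschitz_diff[OF D[OF d(1)] f]]
        by (simp add: lip_norm_minus_commute[of f])
      also have "lip_eval ?\<tau> f \<le> c"
        using d(1) by (intro le) (auto simp: \<Theta>_def)
      finally show "lip_norm f \<le> c + e"
        using d(2) n by simp
    qed
  qed
qed

section \<open>Measures below the real-valued measurable cardinals\<close>

text \<open>
  A diffuse non-zero finite measure on all subsets of \<open>D\<close> produces a real-valued measurable
  cardinal: among the index sets \<open>K\<close> of families of null sets with non-null union take one of least
  cardinality, and push the measure on that union forward to \<open>K\<close>. Minimality of \<open>K\<close> is exactly
  the additivity demanded in the definition.
\<close>
lemma diffuse_measure_imp_real_valued_measurable:
  fixes \<nu> :: "'d measure"
  assumes fin: "finite_measure \<nu>" and sp: "space \<nu> = D" and sets: "sets \<nu> = Pow D"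
    and diffuse: "\<And>x. x \<in> D \<Longrightarrow> emeasure \<nu> {x} = 0" and pos: "emeasure \<nu> D \<noteq> 0"
  shows "\<exists>\<kappa>::'d rel. real_valued_measurable \<kappa> \<and> \<kappa> \<le>o card_of D"
proof -
  interpret finite_measure \<nu> by (rule fin)
  define bad :: "'d set \<Rightarrow> bool" where
    "bad K \<longleftrightarrow> K \<subseteq> D \<and> (\<exists>N. (\<forall>k\<in>K. N k \<subseteq> D \<and> emeasure \<nu> (N k) = 0) \<and> emeasure \<nu> (\<Union>k\<in>K. N k) \<noteq> 0)" for K
  have "bad D"
    unfolding bad_def using diffuse pos by (auto intro!: exI[of _ "\<lambda>x. {x}"])
  then have "card_of ` {K. bad K} \<noteq> {}" by blast
  moreover have "\<forall>r\<in>card_of ` {K. bad K}. Card_order r"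
    using card_of_Card_order by blast
  ultimately obtain K where K: "bad K" and min: "\<And>K'. bad K' \<Longrightarrow> card_of K \<le>o card_of K'"
    using exists_minim_Card_order[of "card_of ` {K. bad K}"] by blast
  obtain N where N: "\<And>k. k \<in> K \<Longrightarrow> N k \<subseteq> D" "\<And>k. k \<in> K \<Longrightarrow> emeasure \<nu> (N k) = 0"
    and U: "emeasure \<nu> (\<Union>k\<in>K. N k) \<noteq> 0" and KD: "K \<subseteq> D"
    using K unfolding bad_def by blast
  define S where "S = (\<Union>k\<in>K. N k)"
  have S: "S \<in> sets \<nu>" "emeasure \<nu> S \<noteq> 0"
    using N U by (auto simp: S_def sets)
  obtain f where f: "\<And>s. s \<in> S \<Longrightarrow> f s \<in> K" "\<And>s. s \<in> S \<Longrightarrow> s \<in> N (f s)"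
    unfolding S_def by (metis UN_E)
  define \<pi> where "\<pi> = distr (uniform_measure \<nu> S) (count_space K) (\<lambda>s. if s \<in> S then f s else (SOME k. k \<in> K))"
  have Kne: "(SOME k. k \<in> K) \<in> K"
    using U by (intro someI_ex[of "\<lambda>k. k \<in> K"]) (cases "K = {}", auto)
  have meas: "(\<lambda>s. if s \<in> S then f s else (SOME k. k \<in> K)) \<in> uniform_measure \<nu> S \<rightarrow>\<^sub>M count_space K"
    using f(1) Kne by (auto simp: measurable_def sets sp)
  have em: "emeasure \<pi> B = emeasure \<nu> {s\<in>S. f s \<in> B} / emeasure \<nu> S" if "B \<subseteq> K" for B
  proof -
    have "S \<inter> ((\<lambda>s. if s \<in> S then f s else (SOME k. k \<in> K)) -` B \<inter> D) = {s\<in>S. f s \<in> B}"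
      using S(1) by (auto simp: sets)
    then show ?thesis
      unfolding \<pi>_def using S that by (subst emeasure_distr[OF meas]) (auto simp: sp sets)
  qed
  have null_iff: "emeasure \<pi> B = 0 \<longleftrightarrow> emeasure \<nu> {s\<in>S. f s \<in> B} = 0" if "B \<subseteq> K" for B
    using S(2) by (simp add: em[OF that])
  have "prob_space \<pi>"
    unfolding \<pi>_def using S by (intro prob_space.prob_space_distr prob_space_uniform_measure meas) auto
  moreover have "emeasure \<pi> {k} = 0" if "k \<in> K" for k
  proof -
    have "{s\<in>S. f s \<in> {k}} \<subseteq> N k" using f by auto
    then have "emeasure \<nu> {s\<in>S. f s \<in> {k}} \<le> emeasure \<nu> (N k)"
      using N that by (intro emeasure_mono) (auto simp: sets)
    then show ?thesis
      using N(2)[OF that] that by (subst null_iff) auto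
  qed
  moreover have "emeasure \<pi> (\<Union>\<N>) = 0"
    if \<N>: "\<N> \<subseteq> Pow K" "card_of \<N> <o card_of K" "\<forall>N\<in>\<N>. emeasure \<pi> N = 0" for \<N>
  proof (rule ccontr)
    assume nz: "emeasure \<pi> (\<Union>\<N>) \<noteq> 0"
    have "card_of \<N> \<le>o card_of K"
      using \<N>(2) ordLess_imp_ordLeq by blast
    then obtain g where g: "inj_on g \<N>" "g ` \<N> \<subseteq> K"
      using card_of_ordLeq[of \<N> K] by blast
    define N' where "N' k = {s\<in>S. f s \<in> the_inv_into \<N> g k}" for k
    have eq: "N' (g n) = {s\<in>S. f s \<in> n}" if "n \<in> \<N>" for n
      using that g by (simp add: N'_def the_inv_into_f_f)
    have un: "(\<Union>k\<in>g ` \<N>. N' k) = {s\<in>S. f s \<in> \<Union>\<N>}"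
      using eq by auto
    have "bad (g ` \<N>)"
      unfolding bad_def
    proof (intro conjI exI[of _ N'])
      show "g ` \<N> \<subseteq> D" using g KD by auto
      show "\<forall>k\<in>g ` \<N>. N' k \<subseteq> D \<and> emeasure \<nu> (N' k) = 0"
      proof
        fix k assume "k \<in> g ` \<N>"
        then obtain n where n: "n \<in> \<N>" "k = g n" by blast
        then have "emeasure \<nu> {s\<in>S. f s \<in> n} = 0"
          using \<N> null_iff[of n] by auto
        then show "N' k \<subseteq> D \<and> emeasure \<nu> (N' k) = 0"
          using n eq S(1) by (auto simp: sets)
      qed
      show "emeasure \<nu> (\<Union>k\<in>g ` \<N>. N' k) \<noteq> 0"
        using nz null_iff[of "\<Union>\<N>"] \<N>(1) unfolding un by blast
    qed
    then have "card_of K \<le>o card_of (g ` \<N>)" by (rule min)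
    also have "card_of (g ` \<N>) \<le>o card_of \<N>" by (rule card_of_image)
    finally show False
      using \<N>(2) not_ordLess_ordLeq by blast
  qed
  ultimately have "real_valued_measurable (card_of K)"
    unfolding real_valued_measurable_def using card_of_Card_order card_of_refl
    by (intro conjI exI[of _ K] exI[of _ \<pi>]) (auto simp: \<pi>_def)
  then show ?thesis
    using card_of_mono1[OF KD] by blast
qed

lemma finite_measure_Pow_countable_support:
  fixes \<nu> :: "'d measure"
  assumes fin: "finite_measure \<nu>" and sp: "space \<nu> = D" and sets: "sets \<nu> = Pow D"
    and small: "\<And>\<kappa>::'d rel. real_valued_measurable \<kappa> \<Longrightarrow> card_of D <o \<kappa>"
  obtains C where "countable C" "C \<subseteq> D" "emeasure \<nu> (D - C) = 0"
proof -
  interpret finite_measure \<nu> by (rule fin)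
  define C where "C = {x. measure \<nu> {x} \<noteq> 0}"
  have C: "countable C" unfolding C_def by (rule countable_support)
  have CD: "C \<subseteq> D"
    using measure_notin_sets[of _ \<nu>] by (auto simp: C_def sets)
  let ?\<rho> = "restrict_space \<nu> (D - C)"
  have in_sets: "D - C \<inter> D \<in> sets \<nu>" by (auto simp: sets)
  have "emeasure \<nu> (D - C) = 0"
  proof (rule ccontr)
    assume nz: "emeasure \<nu> (D - C) \<noteq> 0"
    have em: "emeasure ?\<rho> B = emeasure \<nu> B" if "B \<subseteq> D - C" for B
      using that by (intro emeasure_restrict_space) (auto simp: sets sp)
    have "\<exists>\<kappa>::'d rel. real_valued_measurable \<kappa> \<and> \<kappa> \<le>o card_of (D - C)"
    proof (rule diffuse_measure_imp_real_valued_measurable[of ?\<rho>])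
      show "finite_measure ?\<rho>"
        by (intro finite_measure_restrict_space fin) (auto simp: sets sp)
      show "space ?\<rho> = D - C" by (auto simp: space_restrict_space sp)
      show "sets ?\<rho> = Pow (D - C)" by (auto simp: sets_restrict_space sets)
      show "emeasure ?\<rho> {x} = 0" if "x \<in> D - C" for x
        using that by (subst em) (auto simp: C_def emeasure_eq_measure)
      show "emeasure ?\<rho> (D - C) \<noteq> 0" using nz by (subst em) auto
    qed
    then obtain \<kappa> :: "'d rel" where \<kappa>: "real_valued_measurable \<kappa>" "\<kappa> \<le>o card_of (D - C)"
      by blast
    have "\<kappa> \<le>o card_of D"
      using \<kappa>(2) card_of_mono1[of "D - C" D] ordLeq_transitive by blast
    then show False
      using small[OF \<kappa>(1)] not_ordLess_ordLeq by blast
  qed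
  with C CD show ?thesis by (rule that)
qed

text \<open>
  A form of Stone's theorem on the paracompactness of metric spaces: the balls of one radius around
  a dense set \<open>D\<close>, taken along a well-order of \<open>D\<close>, shrink to countably many disjoint families of
  open sets that still cover the space.
\<close>
lemma (in Metric_space) sigma_disjoint_open_cover:
  assumes D: "D \<subseteq> M" "mtopology closure_of D = M" and "0 < \<epsilon>"
  obtains E :: "nat \<Rightarrow> 'a \<Rightarrow> 'a set" where
    "\<And>n \<alpha>. openin mtopology (E n \<alpha>)" "\<And>n \<alpha>. \<alpha> \<in> D \<Longrightarrow> E n \<alpha> \<subseteq> mball \<alpha> \<epsilon>"
    "\<And>n. disjoint_family_on (E n) D" "M \<subseteq> (\<Union>n. \<Union>\<alpha>\<in>D. E n \<alpha>)"
proof -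
  define r where "r = card_of D"
  have r: "well_order_on D r"
    unfolding r_def by (rule card_of_well_order_on)
  then have tot: "total_on D r" and wf: "wf (r - Id)" and rD: "r \<subseteq> D \<times> D"
    by (auto simp: well_order_on_def linear_order_on_def partial_order_on_def preorder_on_def refl_on_def)
  (* Centres at least 1 / (n + 1) inside the ball of alpha and outside all earlier balls: cores of
     different indices are more than 1 / (n + 1) apart, so their neighbourhoods of half that radius
     are disjoint. *)
  define core where "core n \<alpha> = {x\<in>M. d x \<alpha> < \<epsilon> - 1 / real (Suc n) \<and>
      (\<forall>\<beta>. (\<beta>, \<alpha>) \<in> r - Id \<longrightarrow> \<epsilon> \<le> d x \<beta>)}" for n \<alpha>
  define E where "E n \<alpha> = (\<Union>x\<in>core n \<alpha>. mball x (1 / (2 * real (Suc n))))" for n \<alpha>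
  have separated: "\<not> (w \<in> E n \<alpha> \<and> w \<in> E n \<beta>)" if "(\<beta>, \<alpha>) \<in> r - Id" for w n \<alpha> \<beta>
  proof
    assume "w \<in> E n \<alpha> \<and> w \<in> E n \<beta>"
    then obtain x y where x: "x \<in> core n \<alpha>" "w \<in> mball x (1 / (2 * real (Suc n)))"
      and y: "y \<in> core n \<beta>" "w \<in> mball y (1 / (2 * real (Suc n)))"
      by (auto simp: E_def)
    have \<beta>: "\<beta> \<in> M" using that rD D(1) by auto
    have M: "x \<in> M" "y \<in> M" "w \<in> M" using x y by (auto simp: core_def)
    have "d x \<beta> \<le> d x w + d w y + d y \<beta>"
      using triangle[OF M(1,3) \<beta>] triangle[OF M(3,2) \<beta>] by linarith
    also have "\<dots> < 1 / (2 * real (Suc n)) + 1 / (2 * real (Suc n)) + (\<epsilon> - 1 / real (Suc n))"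
      using x(2) y by (auto simp: core_def commute)
    also have "\<dots> = \<epsilon>" by (simp add: divide_simps)
    finally show False
      using x(1) that by (auto simp: core_def)
  qed
  show ?thesis
  proof (rule that[of E])
    show "openin mtopology (E n \<alpha>)" for n \<alpha>
      by (auto simp: E_def)
    show "disjoint_family_on (E n) D" for n
      unfolding disjoint_family_on_def
    proof (intro ballI impI)
      fix \<alpha> \<beta> assume "\<alpha> \<in> D" "\<beta> \<in> D" "\<alpha> \<noteq> \<beta>"
      then have "(\<alpha>, \<beta>) \<in> r - Id \<or> (\<beta>, \<alpha>) \<in> r - Id"
        using tot by (auto simp: total_on_def)
      then show "E n \<alpha> \<inter> E n \<beta> = {}"
        using separated by blast
    qed
    show "E n \<alpha> \<subseteq> mball \<alpha> \<epsilon>" if "\<alpha> \<in> D" for n \<alpha>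
    proof
      fix w assume "w \<in> E n \<alpha>"
      then obtain x where x: "x \<in> core n \<alpha>" "w \<in> mball x (1 / (2 * real (Suc n)))"
        by (auto simp: E_def)
      have M: "x \<in> M" "w \<in> M" "\<alpha> \<in> M" using x that D(1) by (auto simp: core_def)
      have "d \<alpha> w \<le> d x \<alpha> + d x w"
        using triangle[OF M(3,1,2)] by (simp add: commute)
      also have "\<dots> < (\<epsilon> - 1 / real (Suc n)) + 1 / (2 * real (Suc n))"
        using x by (auto simp: core_def)
      also have "\<dots> \<le> \<epsilon>" by (simp add: frac_le)
      finally show "w \<in> mball \<alpha> \<epsilon>" using M by simp
    qed
    show "M \<subseteq> (\<Union>n. \<Union>\<alpha>\<in>D. E n \<alpha>)"
    proof
      fix x assume x: "x \<in> M"
      let ?A = "{\<alpha>\<in>D. d x \<alpha> < \<epsilon>}"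
      have "x \<in> mtopology closure_of D" using x D(2) by simp
      then have "?A \<noteq> {}"
        using \<open>0 < \<epsilon>\<close> D(1) by (fastforce simp: metric_closure_of)
      then obtain \<alpha> where \<alpha>: "\<alpha> \<in> ?A" and least: "\<And>\<beta>. (\<beta>, \<alpha>) \<in> r - Id \<Longrightarrow> \<beta> \<notin> ?A"
        using wf by (metis (no_types, lifting) ex_in_conv wf_eq_minimal)
      have "0 < \<epsilon> - d x \<alpha>" using \<alpha> by simp
      then obtain n where "1 / real (Suc n) < \<epsilon> - d x \<alpha>"
        using nat_approx_posE by blast
      then have "x \<in> core n \<alpha>"
        using x least rD by (fastforce simp: core_def)
      then have "x \<in> E n \<alpha>"
        using x unfolding E_def by (intro UN_I[of x]) (auto simp: divide_simps)
      then show "x \<in> (\<Union>n. \<Union>\<alpha>\<in>D. E n \<alpha>)" using \<alpha> by auto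
    qed
  qed
qed

text \<open>
  The theorem of Marczewski and Sikorski: the image of a finite measure under a Borel map into a
  metric space of small density is concentrated on a separable set.
\<close>
lemma (in Metric_space) Borel_map_essentially_separable:
  fixes X :: "'w \<Rightarrow> 'a"
  assumes fin: "finite_measure \<mu>"
    and X: "\<And>U. openin mtopology U \<Longrightarrow> X -` U \<inter> space \<mu> \<in> sets \<mu>"
    and XM: "\<And>w. w \<in> space \<mu> \<Longrightarrow> X w \<in> M"
    and small: "dens_below_real_valued_measurable mtopology"
  obtains C N where "countable C" "C \<subseteq> M" "N \<in> null_sets \<mu>"
    "\<And>w \<epsilon>. w \<in> space \<mu> - N \<Longrightarrow> 0 < \<epsilon> \<Longrightarrow> \<exists>c\<in>C. d c (X w) < \<epsilon>"
proof -
  obtain D where D: "dense_in mtopology D" "dens mtopology = card_of D"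
    using dens_properties[of mtopology] by blast
  then have DM: "D \<subseteq> M" "mtopology closure_of D = M"
    by (auto simp: dense_in_def)
  have smallD: "card_of D <o \<kappa>" if "real_valued_measurable \<kappa>" for \<kappa> :: "'a rel"
    using small that D(2) by (simp add: dens_below_real_valued_measurable_def)
  have "\<exists>E :: nat \<Rightarrow> 'a \<Rightarrow> 'a set. (\<forall>n \<alpha>. openin mtopology (E n \<alpha>)) \<and>
      (\<forall>n. \<forall>\<alpha>\<in>D. E n \<alpha> \<subseteq> mball \<alpha> (1 / real (Suc k))) \<and>
      (\<forall>n. disjoint_family_on (E n) D) \<and> M \<subseteq> (\<Union>n. \<Union>\<alpha>\<in>D. E n \<alpha>)" for k
    by (rule sigma_disjoint_open_cover[OF DM, of "1 / real (Suc k)"]) (simp, blast)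
  then obtain E :: "nat \<Rightarrow> nat \<Rightarrow> 'a \<Rightarrow> 'a set" where
      E_open: "\<And>k n \<alpha>. openin mtopology (E k n \<alpha>)"
    and E_ball: "\<And>k n \<alpha>. \<alpha> \<in> D \<Longrightarrow> E k n \<alpha> \<subseteq> mball \<alpha> (1 / real (Suc k))"
    and E_disj: "\<And>k n. disjoint_family_on (E k n) D"
    and E_cover: "\<And>k. M \<subseteq> (\<Union>n. \<Union>\<alpha>\<in>D. E k n \<alpha>)"
    by metis
  (* For fixed k and n the measure of Z k n J is a measure in J, because the family E k n is disjoint. *)
  define Z where "Z k n J = X -` (\<Union>\<alpha>\<in>J. E k n \<alpha>) \<inter> space \<mu>" for k n J
  have Z_sets: "Z k n J \<in> sets \<mu>" for k n J
    unfolding Z_def using E_open by (intro X openin_Union) auto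
  have "\<exists>C. countable C \<and> C \<subseteq> D \<and> emeasure \<mu> (Z k n (D - C)) = 0" for k n
  proof -
    have "\<forall>w\<in>Z k n D. \<exists>\<alpha>\<in>D. X w \<in> E k n \<alpha>"
      by (auto simp: Z_def)
    then obtain f where f: "\<And>w. w \<in> Z k n D \<Longrightarrow> f w \<in> D \<and> X w \<in> E k n (f w)"
      by metis
    have f_vimage: "f -` J \<inter> Z k n D = Z k n J" if "J \<subseteq> D" for J
    proof (intro equalityI subsetI)
      fix w assume w: "w \<in> Z k n J"
      then obtain \<alpha> where \<alpha>: "\<alpha> \<in> J" "X w \<in> E k n \<alpha>" by (auto simp: Z_def)
      have wD: "w \<in> Z k n D" using w that by (auto simp: Z_def)
      have "f w = \<alpha>"
        using disjoint_family_onD[OF E_disj, of "f w" \<alpha> k n] f[OF wD] \<alpha> that by auto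
      then show "w \<in> f -` J \<inter> Z k n D" using wD \<alpha> by simp
    next
      fix w assume "w \<in> f -` J \<inter> Z k n D"
      then show "w \<in> Z k n J" using f[of w] by (auto simp: Z_def)
    qed
    let ?\<mu> = "restrict_space \<mu> (Z k n D)"
    have sp: "space ?\<mu> = Z k n D" by (auto simp: space_restrict_space Z_def)
    have meas: "f \<in> ?\<mu> \<rightarrow>\<^sub>M count_space D"
    proof (rule measurableI)
      fix J assume "J \<in> sets (count_space D)"
      then show "f -` J \<inter> space ?\<mu> \<in> sets ?\<mu>"
        using Z_sets[of k n J] Z_sets[of k n D] f_vimage[of J]
        by (subst sets_restrict_space_iff) (auto simp: sp sets.Int_space_eq2)
    qed (use f in \<open>auto simp: sp\<close>)
    have "finite_measure (distr ?\<mu> (count_space D) f)"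
      using Z_sets by (intro finite_measure.finite_measure_distr meas finite_measure_restrict_space fin) auto
    then obtain C where C: "countable C" "C \<subseteq> D" "emeasure (distr ?\<mu> (count_space D) f) (D - C) = 0"
      by (rule finite_measure_Pow_countable_support[of _ D]) (auto intro: smallD)
    have "emeasure (distr ?\<mu> (count_space D) f) (D - C) = emeasure ?\<mu> (Z k n (D - C))"
      by (subst emeasure_distr[OF meas]) (auto simp: sp f_vimage)
    also have "\<dots> = emeasure \<mu> (Z k n (D - C))"
      using Z_sets by (intro emeasure_restrict_space) (auto simp: Z_def)
    finally show ?thesis using C by auto
  qed
  then obtain C where C: "\<And>k n. countable (C k n)" "\<And>k n. C k n \<subseteq> D"
      "\<And>k n. emeasure \<mu> (Z k n (D - C k n)) = 0"
    by metis
  define N where "N = (\<Union>k n. Z k n (D - C k n))"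
  show ?thesis
  proof (rule that[of "\<Union>k n. C k n" N])
    show "countable (\<Union>k n. C k n)" using C(1) by auto
    show "(\<Union>k n. C k n) \<subseteq> M" using C(2) DM by blast
    have "Z k n (D - C k n) \<in> null_sets \<mu>" for k n
      using C(3) Z_sets by auto
    then show "N \<in> null_sets \<mu>"
      unfolding N_def by (intro null_sets_UN) auto
    fix w and \<epsilon> :: real assume w: "w \<in> space \<mu> - N" and "0 < \<epsilon>"
    then obtain k where k: "1 / real (Suc k) < \<epsilon>" using nat_approx_posE by blast
    have "X w \<in> M" using XM w by auto
    then obtain n \<alpha> where \<alpha>: "\<alpha> \<in> D" "X w \<in> E k n \<alpha>" using E_cover[of k] by blast
    then have "\<alpha> \<in> C k n" using w by (auto simp: N_def Z_def)
    moreover have "d \<alpha> (X w) < \<epsilon>" using E_ball[OF \<alpha>(1)] \<alpha>(2) k by fastforce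
    ultimately show "\<exists>c\<in>\<Union>k n. C k n. d c (X w) < \<epsilon>" by blast
  qed
qed

section \<open>Continuity of time shifts in mean\<close>

text \<open>The points \<open>(\<omega>, t)\<close> such that \<open>0 \<le> t\<close>, \<open>t + u \<le> T\<close> and exactly one of \<open>(\<omega>, t)\<close>, \<open>(\<omega>, t + u)\<close> lies in \<open>A\<close>.\<close>
definition shift_change :: "'a measure \<Rightarrow> real \<Rightarrow> ('a \<times> real) set \<Rightarrow> real \<Rightarrow> ('a \<times> real) set" where
  "shift_change M T A u =
     {x \<in> space (M \<Otimes>\<^sub>M lborel). 0 \<le> snd x \<and> snd x + u \<le> T \<and> (x \<in> A \<longleftrightarrow> (fst x, snd x + u) \<notin> A)}"

lemma sets_shift_change [measurable]:
  assumes [measurable]: "A \<in> sets (M \<Otimes>\<^sub>M lborel)"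
  shows "shift_change M T A u \<in> sets (M \<Otimes>\<^sub>M lborel)"
  unfolding shift_change_def by measurable

lemma nn_integral_lborel_shift:
  fixes f :: "real \<Rightarrow> ennreal"
  assumes "f \<in> borel_measurable borel"
  shows "(\<integral>\<^sup>+x. f (a + x) \<partial>lborel) = (\<integral>\<^sup>+x. f x \<partial>lborel)"
  using nn_integral_real_affine[OF assms, of 1 a] by simp

lemma sets_time_strip [measurable]: "space M \<times> {a..b::real} \<in> sets (M \<Otimes>\<^sub>M lborel)"
  by auto

context prob_space
begin

lemma emeasure_time_strip:
  fixes a b :: real
  assumes "a \<le> b"
  shows "emeasure (M \<Otimes>\<^sub>M lborel) (space M \<times> {a..b}) = ennreal (b - a)"
    and "emeasure (M \<Otimes>\<^sub>M lborel) (space M \<times> {a<..b}) = ennreal (b - a)"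
  using assms emeasure_space_1 by (simp_all add: lborel.emeasure_pair_measure_Times)

lemma emeasure_time_shift:
  fixes u :: real
  assumes A [measurable]: "A \<in> sets (M \<Otimes>\<^sub>M lborel)"
  shows "emeasure (M \<Otimes>\<^sub>M lborel) {x \<in> space (M \<Otimes>\<^sub>M lborel). (fst x, snd x + u) \<in> A} =
    emeasure (M \<Otimes>\<^sub>M lborel) A"
proof -
  have "emeasure (M \<Otimes>\<^sub>M lborel) {x \<in> space (M \<Otimes>\<^sub>M lborel). (fst x, snd x + u) \<in> A} =
      (\<integral>\<^sup>+\<omega>. (\<integral>\<^sup>+t. indicator A (\<omega>, u + t) \<partial>lborel) \<partial>M)"
    by (subst lborel.emeasure_pair_measure, measurable)
       (intro nn_integral_cong, simp add: space_pair_measure indicator_def add.commute)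
  also have "\<dots> = (\<integral>\<^sup>+\<omega>. (\<integral>\<^sup>+t. indicator A (\<omega>, t) \<partial>lborel) \<partial>M)"
    by (intro nn_integral_cong nn_integral_lborel_shift[where f = "\<lambda>t. indicator A (_, t)"]) measurable
  also have "\<dots> = emeasure (M \<Otimes>\<^sub>M lborel) A"
    by (subst lborel.emeasure_pair_measure[OF A]) simp
  finally show ?thesis .
qed

lemma emeasure_shift_change_le:
  assumes A [measurable]: "A \<in> sets (M \<Otimes>\<^sub>M lborel)" and "0 \<le> u"
  shows "emeasure (M \<Otimes>\<^sub>M lborel) (shift_change M T A u) \<le>
    2 * emeasure (M \<Otimes>\<^sub>M lborel) (A \<inter> space M \<times> {0..T})"
proof -
  have B: "A \<inter> space M \<times> {0..T} \<in> sets (M \<Otimes>\<^sub>M lborel)" by measurable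
  let ?S = "{x \<in> space (M \<Otimes>\<^sub>M lborel). (fst x, snd x + u) \<in> A \<inter> space M \<times> {0..T}}"
  have S: "?S \<in> sets (M \<Otimes>\<^sub>M lborel)" using B by measurable
  have "emeasure (M \<Otimes>\<^sub>M lborel) (shift_change M T A u) \<le>
      emeasure (M \<Otimes>\<^sub>M lborel) ((A \<inter> space M \<times> {0..T}) \<union> ?S)"
    using assms(2) B S
    by (intro emeasure_mono) (auto simp: shift_change_def space_pair_measure)
  also have "\<dots> \<le> emeasure (M \<Otimes>\<^sub>M lborel) (A \<inter> space M \<times> {0..T}) + emeasure (M \<Otimes>\<^sub>M lborel) ?S"
    by (intro emeasure_subadditive B S)
  also have "\<dots> = 2 * emeasure (M \<Otimes>\<^sub>M lborel) (A \<inter> space M \<times> {0..T})"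
    by (simp only: emeasure_time_shift[OF B] mult_2)
  finally show ?thesis .
qed

lemma emeasure_strip_finite:
  fixes T :: real
  shows "emeasure (M \<Otimes>\<^sub>M lborel) (A \<inter> space M \<times> {0..T}) < \<infinity>"
proof -
  have "emeasure (M \<Otimes>\<^sub>M lborel) (A \<inter> space M \<times> {0..T}) \<le>
      emeasure (M \<Otimes>\<^sub>M lborel) (space M \<times> {0..T})"
    by (intro emeasure_mono sets_time_strip) auto
  also have "\<dots> < \<infinity>"
    by (cases "0 \<le> T") (auto simp: emeasure_time_strip)
  finally show ?thesis .
qed

lemma emeasure_shift_change_finite:
  assumes "A \<in> sets (M \<Otimes>\<^sub>M lborel)" "0 \<le> u"
  shows "emeasure (M \<Otimes>\<^sub>M lborel) (shift_change M T A u) < \<infinity>"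
  using emeasure_shift_change_le[OF assms, of T] emeasure_strip_finite[of A T]
  by (auto simp: ennreal_mult_less_top intro: le_less_trans)

lemma measure_shift_change_le:
  assumes "A \<in> sets (M \<Otimes>\<^sub>M lborel)" "0 \<le> u"
  shows "measure (M \<Otimes>\<^sub>M lborel) (shift_change M T A u) \<le>
    2 * measure (M \<Otimes>\<^sub>M lborel) (A \<inter> space M \<times> {0..T})"
proof -
  have "ennreal (measure (M \<Otimes>\<^sub>M lborel) (shift_change M T A u)) \<le>
      2 * ennreal (measure (M \<Otimes>\<^sub>M lborel) (A \<inter> space M \<times> {0..T}))"
    using emeasure_shift_change_le[OF assms, of T] emeasure_shift_change_finite[OF assms, of T]
      emeasure_strip_finite[of A T]
    by (simp add: emeasure_eq_ennreal_measure less_top)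
  also have "\<dots> = ennreal (2 * measure (M \<Otimes>\<^sub>M lborel) (A \<inter> space M \<times> {0..T}))"
    by (simp add: ennreal_mult)
  finally show ?thesis by simp
qed

text \<open>
  For a rectangle \<open>a \<times> {..x}\<close> the changes within lag \<open>u\<close> lie in a strip of width \<open>u\<close>; the sets with
  the asserted property form a Dynkin system, where Tannery's theorem handles disjoint unions.
\<close>
lemma tendsto_measure_shift_change:
  assumes "A \<in> sets (M \<Otimes>\<^sub>M lborel)"
  shows "((\<lambda>u. measure (M \<Otimes>\<^sub>M lborel) (shift_change M T A u)) \<longlongrightarrow> 0) (at_right 0)"
proof -
  let ?\<mu> = "M \<Otimes>\<^sub>M (lborel :: real measure)"
  let ?R = "{a \<times> b | a b. a \<in> sets M \<and> b \<in> range (atMost :: real \<Rightarrow> _)}"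
  have sets_eq: "sets ?\<mu> = sigma_sets (space M \<times> UNIV) ?R"
  proof -
    have "sets ?\<mu> = sets (sigma (space M \<times> space (lborel :: real measure)) ?R)"
    proof (rule sets_pair_eq[where Ca = "{space M}" and Cb = "range (\<lambda>n::nat. {..real n})"])
      show "sets (lborel :: real measure) = sigma_sets (space lborel) (range atMost)"
        by (simp add: borel_eq_atMost)
      show "\<Union>(range (\<lambda>n::nat. {..real n})) = space lborel"
        using real_arch_simple by auto
    qed (auto simp: sets.space_closed sets.sigma_sets_eq)
    also have "\<dots> = sigma_sets (space M \<times> UNIV) ?R"
      using sets.sets_into_space by (subst sets_measure_of) fastforce+
    finally show ?thesis .
  qed
  have "Int_stable ?R"
  proof (rule Int_stableI, clarify)
    fix a b :: "'a set" and x y :: real assume "a \<in> sets M" "b \<in> sets M"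
    moreover have "(a \<times> {..x}) \<inter> (b \<times> {..y}) = (a \<inter> b) \<times> {..min x y}" by auto
    ultimately show "\<exists>a' b'. (a \<times> {..x}) \<inter> (b \<times> {..y}) = a' \<times> b' \<and> a' \<in> sets M \<and> b' \<in> range atMost"
      by blast
  qed
  moreover have "?R \<subseteq> Pow (space M \<times> UNIV)"
    using sets.sets_into_space by fastforce
  moreover have "A \<in> sigma_sets (space M \<times> UNIV) ?R"
    using assms sets_eq by simp
  ultimately show ?thesis
  proof (induction rule: sigma_sets_induct_disjoint)
    case (basic B)
    then obtain a x where B: "B = a \<times> {..x}" and a: "a \<in> sets M" by auto
    have le: "measure ?\<mu> (shift_change M T B u) \<le> u" if "0 < u" for u
    proof -
      have "shift_change M T B u \<subseteq> space M \<times> {x - u<..x}"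
        using that by (auto simp: shift_change_def B space_pair_measure)
      then have "emeasure ?\<mu> (shift_change M T B u) \<le> emeasure ?\<mu> (space M \<times> {x - u<..x})"
        by (intro emeasure_mono) auto
      also have "\<dots> = ennreal u"
        using that by (simp add: emeasure_time_strip)
      finally show ?thesis
        using that by (auto simp: measure_def enn2real_leI)
    qed
    show ?case
    proof (rule tendsto_sandwich[of "\<lambda>_. 0" _ _ "\<lambda>u. u"])
      show "\<forall>\<^sub>F u in at_right 0. measure ?\<mu> (shift_change M T B u) \<le> u"
        using le by (auto simp: eventually_at_filter)
    qed (auto intro: tendsto_eq_intros)
  next
    case empty
    then show ?case by (simp add: shift_change_def)
  next
    case (compl B)
    have "shift_change M T (space M \<times> UNIV - B) u = shift_change M T B u" for u
      by (auto simp: shift_change_def space_pair_measure)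
    then show ?case using compl by simp
  next
    case (union B)
    have B [measurable]: "B i \<in> sets ?\<mu>" for i
      using union(2) sets_eq by auto
    let ?m = "\<lambda>i u. measure ?\<mu> (shift_change M T (B i) u)"
    let ?b = "\<lambda>i. measure ?\<mu> (B i \<inter> space M \<times> {0..T})"
    have "(\<lambda>i. ?b i) sums measure ?\<mu> (\<Union>i. B i \<inter> space M \<times> {0..T})"
    proof (rule measure_UNION)
      show "disjoint_family (\<lambda>i. B i \<inter> space M \<times> {0..T})"
        using union(1) by (auto simp: disjoint_family_on_def)
      show "emeasure ?\<mu> (\<Union>i. B i \<inter> space M \<times> {0..T}) \<noteq> \<infinity>"
        using emeasure_strip_finite[of "\<Union>i. B i" T] by (simp flip: Int_UN_distrib2)
      show "range (\<lambda>i. B i \<inter> space M \<times> {0..T}) \<subseteq> sets ?\<mu>"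
        by (intro image_subsetI sets.Int B sets_time_strip)
    qed
    then have summable: "summable (\<lambda>i. 2 * ?b i)"
      by (intro summable_mult) (rule sums_summable)
    have bound: "norm (?m i u) \<le> 2 * ?b i" if "0 < u" for i u
      using measure_shift_change_le[OF B, of u] that by simp
    have lim: "((\<lambda>u. \<Sum>i. ?m i u) \<longlongrightarrow> (\<Sum>i. 0)) (at_right 0)"
    proof (rule tannerys_theorem[THEN conjunct2, THEN conjunct2])
      have "\<forall>\<^sub>F u :: real in at_right 0. 0 < u"
        by (auto simp: eventually_at_filter)
      then have "\<forall>\<^sub>F x in at_top \<times>\<^sub>F at_right (0::real). 0 < snd x"
        by (rule eventually_compose_filterlim[OF _ filterlim_snd])
      then show "\<forall>\<^sub>F (i, u) in at_top \<times>\<^sub>F at_right 0. norm (?m i u) \<le> 2 * ?b i"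
        by eventually_elim (use bound in auto)
    qed (use union summable in auto)
    have le: "measure ?\<mu> (shift_change M T (\<Union>i. B i) u) \<le> (\<Sum>i. ?m i u)" if "0 < u" for u
    proof -
      have sm: "summable (\<lambda>i. ?m i u)"
        using bound[OF that] by (intro summable_comparison_test'[OF summable]) auto
      have "(\<Sum>i. emeasure ?\<mu> (shift_change M T (B i) u)) = ennreal (\<Sum>i. ?m i u)"
        using emeasure_shift_change_finite[OF B, of u] that sm
        by (subst suminf_ennreal2[symmetric]) (auto simp: emeasure_eq_ennreal_measure less_top)
      moreover have "shift_change M T (\<Union>i. B i) u \<subseteq> (\<Union>i. shift_change M T (B i) u)"
        by (auto simp: shift_change_def)
      then have "emeasure ?\<mu> (shift_change M T (\<Union>i. B i) u) \<le>
          emeasure ?\<mu> (\<Union>i. shift_change M T (B i) u)"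
        by (intro emeasure_mono sets.countable_UN image_subsetI sets_shift_change B)
      moreover have "\<dots> \<le> (\<Sum>i. emeasure ?\<mu> (shift_change M T (B i) u))"
        by (intro emeasure_subadditive_countably image_subsetI sets_shift_change B)
      ultimately have "emeasure ?\<mu> (shift_change M T (\<Union>i. B i) u) \<le> ennreal (\<Sum>i. ?m i u)"
        by simp
      then show ?thesis
        using suminf_nonneg[OF sm] by (auto simp: measure_def intro: enn2real_leI)
    qed
    show ?case
    proof (rule tendsto_sandwich[of "\<lambda>_. 0" _ _ "\<lambda>u. \<Sum>i. ?m i u"])
      show "\<forall>\<^sub>F u in at_right 0. measure ?\<mu> (shift_change M T (\<Union>i. B i) u) \<le> (\<Sum>i. ?m i u)"
        using le by (auto simp: eventually_at_filter)
    qed (use lim in auto)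
  qed
qed

end

section \<open>Sampling along randomly shifted grids\<close>

text \<open>
  Averaging over the offset \<open>s\<close> of the grid \<open>s, s + h, s + 2 h, \<dots>\<close> turns the deviation from the last
  grid point into the mean deviation over all time lags up to \<open>h\<close>; so some offset stays below twice
  any bound that holds for each of these lags.
\<close>
lemma exists_grid_offset:
  fixes \<psi> :: "real \<Rightarrow> real \<Rightarrow> ennreal" and T h \<eta> :: real
  assumes [measurable]: "case_prod \<psi> \<in> borel_measurable (lborel \<Otimes>\<^sub>M lborel)"
    and h: "0 < h" "real n * h \<le> T" and "0 < \<eta>"
    and lag: "\<And>u. 0 < u \<Longrightarrow> u \<le> h \<Longrightarrow>
       (\<integral>\<^sup>+r. indicator {0..T} r * (indicator {..T} (r + u) * \<psi> r (r + u)) \<partial>lborel) \<le> ennreal \<eta>"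
  shows "\<exists>s. 0 < s \<and> s < h \<and>
    (\<Sum>j<n. \<integral>\<^sup>+t. indicator ({s + real j * h<..s + real (Suc j) * h} \<inter> {..T}) t *
       \<psi> (s + real j * h) t \<partial>lborel) < ennreal (2 * \<eta>)"
proof (rule ccontr)
  define \<Phi> where "\<Phi> r u = indicator {0<..h} u * (indicator {..T} (r + u) * \<psi> r (r + u))" for r u
  have [measurable]: "(\<lambda>(r, u). \<psi> r (r + u)) \<in> borel_measurable (lborel \<Otimes>\<^sub>M lborel)"
  proof -
    have "(\<lambda>x. case_prod \<psi> (fst x, fst x + snd x)) \<in> borel_measurable (lborel \<Otimes>\<^sub>M lborel)"
      by measurable
    then show ?thesis by (simp add: case_prod_beta')
  qed
  have [measurable]: "(\<lambda>(r, u). \<Phi> r u) \<in> borel_measurable (lborel \<Otimes>\<^sub>M lborel)"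
    unfolding \<Phi>_def by measurable
  let ?J = "\<lambda>r. \<integral>\<^sup>+u. \<Phi> r u \<partial>lborel"
  have [measurable]: "?J \<in> borel_measurable lborel"
    by measurable
  assume "\<not> ?thesis"
  then have large: "ennreal (2 * \<eta>) \<le> (\<Sum>j<n. \<integral>\<^sup>+t. indicator ({s + real j * h<..s + real (Suc j) * h} \<inter> {..T}) t *
       \<psi> (s + real j * h) t \<partial>lborel)" if "0 < s" "s < h" for s
    using that by (meson linorder_not_less)
  have shift: "(\<integral>\<^sup>+t. indicator ({s + real j * h<..s + real (Suc j) * h} \<inter> {..T}) t *
       \<psi> (s + real j * h) t \<partial>lborel) = ?J (real j * h + s)" for s j
  proof -
    let ?a = "s + real j * h"
    have "\<psi> ?a \<in> borel_measurable borel"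
      using measurable_compose[OF measurable_Pair1' assms(1), of ?a] by simp
    then have f: "(\<lambda>t. indicator ({?a<..s + real (Suc j) * h} \<inter> {..T}) t * \<psi> ?a t) \<in> borel_measurable borel"
      by (intro borel_measurable_times_ennreal borel_measurable_indicator sets.Int) auto
    have "(\<integral>\<^sup>+t. indicator ({?a<..s + real (Suc j) * h} \<inter> {..T}) t * \<psi> ?a t \<partial>lborel) =
        (\<integral>\<^sup>+u. indicator ({?a<..s + real (Suc j) * h} \<inter> {..T}) (?a + u) * \<psi> ?a (?a + u) \<partial>lborel)"
      by (rule nn_integral_lborel_shift[OF f, symmetric])
    also have "\<dots> = ?J (real j * h + s)"
      by (intro nn_integral_cong) (auto simp: \<Phi>_def algebra_simps split: split_indicator)
    finally show ?thesis .
  qed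
  have "(\<integral>\<^sup>+s. ennreal (2 * \<eta>) * indicator {0<..<h} s \<partial>lborel) \<le>
      (\<integral>\<^sup>+s. indicator {0<..<h} s * (\<Sum>j<n. ?J (real j * h + s)) \<partial>lborel)"
    using large unfolding shift by (intro nn_integral_mono) (auto split: split_indicator)
  also have "\<dots> = (\<Sum>j<n. \<integral>\<^sup>+s. indicator {0<..<h} s * ?J (real j * h + s) \<partial>lborel)"
    unfolding sum_distrib_left by (intro nn_integral_sum) measurable
  also have "\<dots> = (\<Sum>j<n. \<integral>\<^sup>+r. indicator {real j * h<..<real (Suc j) * h} r * ?J r \<partial>lborel)"
  proof (intro sum.cong refl)
    fix j
    have "(\<integral>\<^sup>+s. indicator {0<..<h} s * ?J (real j * h + s) \<partial>lborel) =
      (\<integral>\<^sup>+s. indicator {real j * h<..<real (Suc j) * h} (real j * h + s) * ?J (real j * h + s) \<partial>lborel)"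
      by (intro nn_integral_cong) (auto simp: algebra_simps split: split_indicator)
    also have "\<dots> = (\<integral>\<^sup>+r. indicator {real j * h<..<real (Suc j) * h} r * ?J r \<partial>lborel)"
      by (intro nn_integral_lborel_shift[where f = "\<lambda>r. indicator {real j * h<..<real (Suc j) * h} r * ?J r"])
         measurable
    finally show "(\<integral>\<^sup>+s. indicator {0<..<h} s * ?J (real j * h + s) \<partial>lborel) =
      (\<integral>\<^sup>+r. indicator {real j * h<..<real (Suc j) * h} r * ?J r \<partial>lborel)" .
  qed
  also have "\<dots> = (\<integral>\<^sup>+r. (\<Sum>j<n. indicator {real j * h<..<real (Suc j) * h} r) * ?J r \<partial>lborel)"
    unfolding sum_distrib_right by (intro nn_integral_sum[symmetric]) measurable
  also have "\<dots> \<le> (\<integral>\<^sup>+r. indicator {0..T} r * ?J r \<partial>lborel)"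
  proof (intro nn_integral_mono mult_right_mono)
    fix r :: real
    have disj: "disjoint_family_on (\<lambda>j. {real j * h<..<real (Suc j) * h}) {..<n}"
    proof (unfold disjoint_family_on_def, intro ballI impI)
      fix i j :: nat assume "i \<noteq> j"
      then have "real (Suc i) \<le> real j \<or> real (Suc j) \<le> real i" by linarith
      then have "real (Suc i) * h \<le> real j * h \<or> real (Suc j) * h \<le> real i * h"
        using h by (auto intro: mult_right_mono)
      then show "{real i * h<..<real (Suc i) * h} \<inter> {real j * h<..<real (Suc j) * h} = {}"
        by auto
    qed
    have sub: "(\<Union>j<n. {real j * h<..<real (Suc j) * h}) \<subseteq> {0..T}"
    proof
      fix r assume "r \<in> (\<Union>j<n. {real j * h<..<real (Suc j) * h})"
      then obtain j where j: "j < n" "real j * h < r" "r < real (Suc j) * h" by auto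
      have "real (Suc j) * h \<le> real n * h"
        using j(1) h by (intro mult_right_mono) auto
      moreover have "0 \<le> real j * h" using h by simp
      ultimately show "r \<in> {0..T}" using j h(2) by auto
    qed
    have "(\<Sum>j<n. indicator {real j * h<..<real (Suc j) * h} r) =
        (indicator (\<Union>j<n. {real j * h<..<real (Suc j) * h}) r :: ennreal)"
      by (rule indicator_UN_disjoint[OF _ disj, symmetric]) simp
    also have "\<dots> \<le> indicator {0..T} r"
      by (rule indicator_leI) (use sub in blast)
    finally show "(\<Sum>j<n. indicator {real j * h<..<real (Suc j) * h} r) \<le> (indicator {0..T} r :: ennreal)" .
  qed simp
  also have "\<dots> = (\<integral>\<^sup>+r. (\<integral>\<^sup>+u. indicator {0..T} r * \<Phi> r u \<partial>lborel) \<partial>lborel)"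
    by (intro nn_integral_cong nn_integral_cmult[symmetric]) measurable
  also have "\<dots> = (\<integral>\<^sup>+u. (\<integral>\<^sup>+r. indicator {0..T} r * \<Phi> r u \<partial>lborel) \<partial>lborel)"
    by (rule lborel_pair.Fubini'[symmetric]) measurable
  also have "\<dots> \<le> (\<integral>\<^sup>+u. ennreal \<eta> * indicator {0<..h} u \<partial>lborel)"
    using lag by (intro nn_integral_mono) (auto simp: \<Phi>_def split: split_indicator)
  also have "\<dots> = ennreal (\<eta> * h)"
    using h \<open>0 < \<eta>\<close> by (subst nn_integral_cmult_indicator) (auto simp: ennreal_mult)
  finally have "ennreal (2 * \<eta> * h) \<le> ennreal (\<eta> * h)"
    using h \<open>0 < \<eta>\<close> by (subst (asm) nn_integral_cmult_indicator) (auto simp: ennreal_mult)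
  then show False
    using h \<open>0 < \<eta>\<close> by simp
qed

lemma pred_eq_nat [measurable (raw)]:
  fixes f g :: "'a \<Rightarrow> nat"
  assumes [measurable]: "f \<in> M \<rightarrow>\<^sub>M count_space UNIV" "g \<in> M \<rightarrow>\<^sub>M count_space UNIV"
  shows "Measurable.pred M (\<lambda>x. f x = g x)"
proof -
  have "Measurable.pred M (\<lambda>x. \<exists>k. f x = k \<and> g x = k)"
    by measurable
  moreover have "(\<lambda>x. \<exists>k. f x = k \<and> g x = k) = (\<lambda>x. f x = g x)"
    by auto
  ultimately show ?thesis by simp
qed

lemma finite_measure_time: "finite_measure (restrict_space lborel {0..T::real})"
  by (rule finite_measureI) (cases "0 \<le> T", auto simp: emeasure_restrict_space space_restrict_space)

context prob_space
begin

lemma finite_measure_time_prod: "finite_measure (time_prod M T)"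
  using finite_measure_pair_measure[OF finite_measure_time finite_measure_axioms] .

lemma emeasure_time_prod:
  assumes [measurable]: "X \<in> sets (time_prod M T)"
  shows "emeasure (time_prod M T) X =
    (\<integral>\<^sup>+t. (\<integral>\<^sup>+\<omega>. indicator X (\<omega>, t) \<partial>M) * indicator {0..T} t \<partial>lborel)"
proof -
  interpret R: finite_measure "restrict_space lborel {0..T}"
    by (rule finite_measure_time)
  interpret P: pair_sigma_finite M "restrict_space lborel {0..T}" ..
  have "emeasure (time_prod M T) X = (\<integral>\<^sup>+x. indicator X x \<partial>time_prod M T)"
    by simp
  also have "\<dots> = (\<integral>\<^sup>+t. (\<integral>\<^sup>+\<omega>. indicator X (\<omega>, t) \<partial>M) \<partial>restrict_space lborel {0..T})"
    by (rule P.nn_integral_snd[symmetric]) measurable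
  also have "\<dots> = (\<integral>\<^sup>+t. (\<integral>\<^sup>+\<omega>. indicator X (\<omega>, t) \<partial>M) * indicator {0..T} t \<partial>lborel)"
    by (rule nn_integral_restrict_space) simp
  finally show ?thesis .
qed

end

text \<open>Numbers \<open>t 0 < \<dots> < t n\<close> cut \<open>(t 0, t n]\<close> into half-open intervals.\<close>

lemma partition_mono:
  fixes t :: "nat \<Rightarrow> real"
  assumes "\<And>i. i < n \<Longrightarrow> t i < t (Suc i)" "i \<le> j" "j \<le> n"
  shows "t i \<le> t j"
  using assms(2,3)
proof (induction j rule: dec_induct)
  case (step j)
  then show ?case using assms(1)[of j] by simp
qed simp

lemma partition_index:
  fixes t :: "nat \<Rightarrow> real"
  assumes "t 0 < \<tau>" "\<tau> \<le> t n"
  shows "\<exists>i<n. t i < \<tau> \<and> \<tau> \<le> t (Suc i)"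
  using assms(2)
proof (induction n)
  case (Suc n)
  then show ?case
    by (cases "\<tau> \<le> t n") (auto simp: not_le intro: less_SucI)
qed (use assms(1) in simp)

lemma partition_sum:
  fixes t :: "nat \<Rightarrow> real"
  assumes t: "\<And>i. i < n \<Longrightarrow> t i < t (Suc i)" and i: "i < n" "t i < \<tau>" "\<tau> \<le> t (Suc i)"
  shows "(\<Sum>k<n. indicator {t k<..t (Suc k)} \<tau> * c k) = (c i :: real)"
proof -
  have "indicator {t k<..t (Suc k)} \<tau> * c k = (if k = i then c i else 0)" if k: "k < n" for k
  proof -
    consider "k = i" | "Suc k \<le> i" | "Suc i \<le> k" by linarith
    then show ?thesis
    proof cases
      case 2
      then have "t (Suc k) \<le> t i" using i by (intro partition_mono[of n t] t) auto
      then show ?thesis using i 2 by auto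
    next
      case 3
      then have "t (Suc i) \<le> t k" using k by (intro partition_mono[of n t] t) auto
      then show ?thesis using i 3 by auto
    qed (use i in auto)
  qed
  then have "(\<Sum>k<n. indicator {t k<..t (Suc k)} \<tau> * c k) = (\<Sum>k<n. if k = i then c i else 0)"
    by (intro sum.cong) auto
  then show ?thesis using i(1) by simp
qed

text \<open>
  Sampling the values \<open>d (g \<omega> t)\<close> at the points of a suitably shifted grid gives an elementary process
  that agrees with them off a set of small measure. Adaptedness suffices, since the value kept on
  \<open>(t i, t (i + 1)]\<close> is the one at the time \<open>t i\<close>.
\<close>
lemma (in filtered_prob_space) exists_elementary_sampling:
  fixes g :: "'a \<times> real \<Rightarrow> nat" and d :: "nat \<Rightarrow> 'y::metric_space \<Rightarrow> real"
  assumes T: "0 < T" and \<eta>: "0 < \<eta>"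
    and g [measurable]: "g \<in> time_prod M T \<rightarrow>\<^sub>M count_space UNIV"
    and gK: "\<And>x. g x < K"
    and adapted: "\<And>t k. t \<in> {0..T} \<Longrightarrow> {\<omega>\<in>space M. g (\<omega>, t) = k} \<in> sets (F t)"
    and d: "\<And>k. k < K \<Longrightarrow> d k \<in> FL L"
  obtains H B where "elementary_process M F T L H" "B \<in> sets (time_prod M T)"
    "emeasure (time_prod M T) B < ennreal \<eta>"
    "\<And>\<omega> t. \<omega> \<in> space M \<Longrightarrow> t \<in> {0..T} \<Longrightarrow> (\<omega>, t) \<notin> B \<Longrightarrow> H \<omega> t = d (g (\<omega>, t))"
    "\<And>\<omega> t. \<omega> \<in> space M \<Longrightarrow> t \<in> {0..T} \<Longrightarrow> \<exists>k<K. H \<omega> t = d k"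
proof -
  let ?\<mu> = "M \<Otimes>\<^sub>M (lborel :: real measure)"
  interpret P: pair_sigma_finite M "lborel :: real measure" ..
  (* The extension of g to all times by its values at the end points. *)
  define g' where "g' x = g (fst x, max 0 (min T (snd x)))" for x
  have [measurable]: "(\<lambda>x. max 0 (min T (snd x))) \<in> ?\<mu> \<rightarrow>\<^sub>M restrict_space lborel {0..T}"
    using T by (intro measurable_restrict_space2) auto
  have g' [measurable]: "g' \<in> ?\<mu> \<rightarrow>\<^sub>M count_space UNIV"
    unfolding g'_def by measurable
  have g'_eq: "g' (\<omega>, t) = g (\<omega>, t)" if "t \<in> {0..T}" for \<omega> t
    using that by (simp add: g'_def)

  define A where "A k = {x\<in>space ?\<mu>. g' x = k}" for k
  have A: "A k \<in> sets ?\<mu>" for k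
    unfolding A_def by measurable
  let ?m = "\<lambda>u. \<Sum>k<K. measure ?\<mu> (shift_change M T (A k) u)"
  have "(?m \<longlongrightarrow> (\<Sum>k<K. 0)) (at_right 0)"
    by (intro tendsto_sum tendsto_measure_shift_change A)
  then have "\<forall>\<^sub>F u in at_right 0. ?m u < \<eta> / 4"
    using \<eta> by (intro order_tendstoD(2)) auto
  then obtain h0 where h0: "0 < h0" "\<And>u. 0 < u \<Longrightarrow> u < h0 \<Longrightarrow> ?m u < \<eta> / 4"
    unfolding eventually_at_right_field by auto

  define \<psi> :: "real \<Rightarrow> real \<Rightarrow> ennreal"
    where "\<psi> r t = (\<integral>\<^sup>+\<omega>. (if g' (\<omega>, r) = g' (\<omega>, t) then 0 else 1) \<partial>M)" for r t
  have \<psi>: "case_prod \<psi> \<in> borel_measurable (lborel \<Otimes>\<^sub>M lborel)"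
  proof -
    have "(\<lambda>x. \<integral>\<^sup>+\<omega>. (if g' (\<omega>, fst x) = g' (\<omega>, snd x) then 0 else 1) \<partial>M)
        \<in> borel_measurable ((lborel :: real measure) \<Otimes>\<^sub>M (lborel :: real measure))"
      by measurable
    then show ?thesis by (simp add: \<psi>_def case_prod_beta')
  qed
  have lag: "(\<integral>\<^sup>+r. indicator {0..T} r * (indicator {..T} (r + u) * \<psi> r (r + u)) \<partial>lborel) \<le> ennreal (\<eta> / 4)"
    if u: "0 < u" "u < h0" for u
  proof -
    let ?D = "{x\<in>space ?\<mu>. 0 \<le> snd x \<and> snd x \<le> T \<and> snd x + u \<le> T \<and> g' x \<noteq> g' (fst x, snd x + u)}"
    have D: "?D \<in> sets ?\<mu>" by measurable
    have "(\<integral>\<^sup>+r. indicator {0..T} r * (indicator {..T} (r + u) * \<psi> r (r + u)) \<partial>lborel) =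
        (\<integral>\<^sup>+r. (\<integral>\<^sup>+\<omega>. indicator ?D (\<omega>, r) \<partial>M) \<partial>lborel)"
      unfolding \<psi>_def
    proof (intro nn_integral_cong)
      fix r :: real
      have [measurable]: "(\<lambda>\<omega>. if g' (\<omega>, r) = g' (\<omega>, r + u) then 0 else 1 :: ennreal) \<in> borel_measurable M"
        by measurable
      have "(\<integral>\<^sup>+\<omega>. indicator ?D (\<omega>, r) \<partial>M) = (\<integral>\<^sup>+\<omega>. (indicator {0..T} r * indicator {..T} (r + u)) *
          (if g' (\<omega>, r) = g' (\<omega>, r + u) then 0 else 1) \<partial>M)"
        by (intro nn_integral_cong) (auto simp: space_pair_measure split: split_indicator)
      then show "indicator {0..T} r * (indicator {..T} (r + u) *
          (\<integral>\<^sup>+\<omega>. (if g' (\<omega>, r) = g' (\<omega>, r + u) then 0 else 1) \<partial>M)) = (\<integral>\<^sup>+\<omega>. indicator ?D (\<omega>, r) \<partial>M)"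
        by (simp add: nn_integral_cmult mult.assoc)
    qed
    also have "\<dots> = (\<integral>\<^sup>+x. indicator ?D x \<partial>?\<mu>)"
      by (rule P.nn_integral_snd[OF borel_measurable_indicator[OF D]])
    also have "\<dots> = emeasure ?\<mu> ?D"
      by (rule nn_integral_indicator[OF D])
    also have "\<dots> \<le> emeasure ?\<mu> (\<Union>k<K. shift_change M T (A k) u)"
    proof (rule emeasure_mono)
      show "(\<Union>k<K. shift_change M T (A k) u) \<in> sets ?\<mu>"
        by (intro sets.finite_UN finite_lessThan sets_shift_change A)
      show "?D \<subseteq> (\<Union>k<K. shift_change M T (A k) u)"
      proof
        fix x assume x: "x \<in> ?D"
        have "g' x < K" unfolding g'_def by (rule gK)
        moreover have "x \<in> shift_change M T (A (g' x)) u"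
          unfolding shift_change_def A_def mem_Collect_eq
          using x by (simp add: space_pair_measure mem_Times_iff)
        ultimately show "x \<in> (\<Union>k<K. shift_change M T (A k) u)" by blast
      qed
    qed
    also have "\<dots> \<le> (\<Sum>k<K. emeasure ?\<mu> (shift_change M T (A k) u))"
      by (intro emeasure_subadditive_finite image_subsetI sets_shift_change A) simp
    also have "\<dots> = (\<Sum>k<K. ennreal (measure ?\<mu> (shift_change M T (A k) u)))"
      using emeasure_shift_change_finite[OF A, of u] u
      by (intro sum.cong emeasure_eq_ennreal_measure) (auto simp: less_top)
    also have "\<dots> = ennreal (?m u)"
      by simp
    also have "\<dots> \<le> ennreal (\<eta> / 4)"
      using h0(2)[OF u] by (intro ennreal_leI) simp
    finally show ?thesis .
  qed

  obtain n where n: "0 < n" "T / real n < h0" "T / real n < \<eta> / 4"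
  proof -
    define m where "m = min h0 (\<eta> / 4)"
    have m: "0 < m" "m \<le> h0" "m \<le> \<eta> / 4" using h0 \<eta> by (auto simp: m_def)
    obtain n where n: "T / m < real n"
      using reals_Archimedean2 by blast
    have "0 < T / m" using T m by simp
    then have "0 < n" using n by (cases "n = 0") auto
    moreover have "T / real n < m"
      using n m \<open>0 < n\<close> by (simp add: field_simps)
    moreover note m
    ultimately show ?thesis by (intro that) (assumption, linarith+)
  qed
  define h where "h = T / real n"
  have h: "0 < h" "real n * h = T" "h < h0" "h < \<eta> / 4"
    using n T by (auto simp: h_def)
  obtain s where s: "0 < s" "s < h" and err:
    "(\<Sum>j<n. \<integral>\<^sup>+t. indicator ({s + real j * h<..s + real (Suc j) * h} \<inter> {..T}) t *
       \<psi> (s + real j * h) t \<partial>lborel) < ennreal (2 * (\<eta> / 4))"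
    using exists_grid_offset[OF \<psi> h(1), of n T "\<eta> / 4"] lag h \<eta> by fastforce

  (* The grid 0, s, s + h, ..., s + (n - 1) h, T. On (0, s] the process keeps the value at time 0, and
     the error there is controlled by s < h < eta / 4 only. *)
  define a where "a j = s + real j * h" for j
  define t where "t i = (if i = 0 then 0 else if i \<le> n then a (i - 1) else T)" for i
  have a_pos: "0 < a j" for j
    using s h by (auto simp: a_def intro: add_pos_nonneg)
  have a_mono: "a j < a (Suc j)" for j
    using h by (simp add: a_def algebra_simps)
  have a_less: "a j < T" if "j < n" for j
  proof -
    have "a j < real (Suc j) * h" using s by (simp add: a_def algebra_simps)
    also have "\<dots> \<le> real n * h" using that h by (intro mult_right_mono) auto
    finally show ?thesis using h by simp
  qed
  have t0: "t 0 = 0" and tn: "t (Suc n) = T" and tSuc: "\<And>j. j < n \<Longrightarrow> t (Suc j) = a j"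
    by (auto simp: t_def)
  have t_less: "t i < t (Suc i)" if "i < Suc n" for i
  proof (cases i)
    case 0
    then show ?thesis using a_pos n by (simp add: t_def)
  next
    case (Suc j)
    then have j: "j < n" using that by simp
    show ?thesis
    proof (cases "Suc j < n")
      case True
      then show ?thesis using a_mono[of j] Suc by (simp add: t_def)
    next
      case False
      then have "Suc j = n" using j by simp
      then show ?thesis using a_less[OF j] Suc by (auto simp: t_def)
    qed
  qed
  have t_range: "t i \<in> {0..T}" if "i \<le> Suc n" for i
    using partition_mono[of "Suc n" t 0 i] partition_mono[of "Suc n" t i "Suc n"] that t_less t0 tn
    by auto

  define \<Xi> where "\<Xi> i \<omega> y = (\<Sum>j<K. d j y * indicator {\<omega>\<in>space M. g (\<omega>, t i) = j} \<omega>)" for i \<omega> y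
  have \<Xi>: "\<Xi> i \<omega> = d (g (\<omega>, t i))" if "\<omega> \<in> space M" for i \<omega>
  proof
    fix y
    have "\<Xi> i \<omega> y = (\<Sum>j<K. if j = g (\<omega>, t i) then d j y else 0)"
      unfolding \<Xi>_def using that by (intro sum.cong) auto
    also have "\<dots> = d (g (\<omega>, t i)) y"
      using gK by simp
    finally show "\<Xi> i \<omega> y = d (g (\<omega>, t i)) y" .
  qed
  define H where "H \<omega> \<tau> y = indicator {0} \<tau> * \<Xi> 0 \<omega> y +
      (\<Sum>i<Suc n. indicator {t i<..t (Suc i)} \<tau> * \<Xi> i \<omega> y)" for \<omega> \<tau> y
  have H_elem: "elementary_process M F T L H"
    unfolding elementary_process_def Let_def
  proof (intro exI conjI)
    show "\<forall>\<omega>\<in>space M. \<forall>\<tau>\<in>{0..T}. \<forall>y. H \<omega> \<tau> y =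
        indicator {0} \<tau> * (\<Sum>j<K. d j y * indicator {\<omega>\<in>space M. g (\<omega>, t 0) = j} \<omega>) +
        (\<Sum>i<Suc n. indicator {t i<..t (Suc i)} \<tau> *
          (\<Sum>j<K. d j y * indicator {\<omega>\<in>space M. g (\<omega>, t i) = j} \<omega>))"
      by (simp add: H_def \<Xi>_def)
    show "\<forall>i<Suc n. (\<forall>j<K. d j \<in> FL L \<and> {\<omega>\<in>space M. g (\<omega>, t i) = j} \<in> sets (F (t i))) \<and>
        disjoint_family_on (\<lambda>j. {\<omega>\<in>space M. g (\<omega>, t i) = j}) {..<K} \<and>
        (\<Union>j<K. {\<omega>\<in>space M. g (\<omega>, t i) = j}) = space M"
      using d adapted t_range gK by (auto simp: disjoint_family_on_def)
  qed (use t0 tn t_less in auto)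
  have H_at: "H \<omega> \<tau> = d (g (\<omega>, t i))"
    if "\<omega> \<in> space M" "i < Suc n" "t i < \<tau>" "\<tau> \<le> t (Suc i)" for \<omega> \<tau> i
  proof
    fix y
    have "0 < \<tau>" using that(3) t_range[of i] that(2) by auto
    then show "H \<omega> \<tau> y = d (g (\<omega>, t i)) y"
      unfolding H_def using partition_sum[OF t_less that(2-4)] \<Xi>[OF that(1)] by simp
  qed
  have index: "\<exists>i<Suc n. t i < \<tau> \<and> \<tau> \<le> t (Suc i)" if "0 < \<tau>" "\<tau> \<le> T" for \<tau>
    using that t0 tn by (intro partition_index) auto
  have H_values: "\<exists>k<K. H \<omega> \<tau> = d k" if "\<omega> \<in> space M" "\<tau> \<in> {0..T}" for \<omega> \<tau>
  proof (cases "\<tau> = 0")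
    case True
    have "(\<Sum>i<Suc n. indicator {t i<..t (Suc i)} (0::real) * \<Xi> i \<omega> y) = 0" for y
    proof (intro sum.neutral ballI)
      fix i assume "i \<in> {..<Suc n}"
      then have "0 \<le> t i" using t_range[of i] by simp
      then show "indicator {t i<..t (Suc i)} (0::real) * \<Xi> i \<omega> y = 0" by simp
    qed
    then have "H \<omega> \<tau> = d (g (\<omega>, t 0))"
      unfolding True H_def using \<Xi>[OF that(1)] by simp
    then show ?thesis using gK by blast
  next
    case False
    then show ?thesis using index[of \<tau>] H_at[OF that(1)] that(2) gK by fastforce
  qed

  define B\<^sub>0 where "B\<^sub>0 = {x\<in>space (time_prod M T). snd x \<le> s}"
  define B\<^sub>1 where "B\<^sub>1 j = {x\<in>space (time_prod M T).
      a j < snd x \<and> snd x \<le> a (Suc j) \<and> g' (fst x, a j) \<noteq> g' x}" for j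
  have "(\<lambda>t. t) \<in> restrict_space lborel {0..T} \<rightarrow>\<^sub>M (lborel :: real measure)"
    by (rule measurable_restrict_space1) simp
  then have snd_meas [measurable]: "snd \<in> time_prod M T \<rightarrow>\<^sub>M (lborel :: real measure)"
    using measurable_compose[OF measurable_snd] by fastforce
  have ident: "(\<lambda>x. (fst x, snd x)) \<in> time_prod M T \<rightarrow>\<^sub>M ?\<mu>"
    by (intro measurable_Pair measurable_fst snd_meas)
  have g'_prod [measurable]: "g' \<in> time_prod M T \<rightarrow>\<^sub>M count_space UNIV"
    using measurable_compose[OF ident g'] by simp
  have B0: "B\<^sub>0 \<in> sets (time_prod M T)"
    unfolding B\<^sub>0_def by measurable
  have B1: "B\<^sub>1 j \<in> sets (time_prod M T)" for j
    unfolding B\<^sub>1_def by measurable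
  have "emeasure (time_prod M T) B\<^sub>0 \<le> (\<integral>\<^sup>+\<tau>. indicator {0..s} \<tau> \<partial>lborel)"
    unfolding emeasure_time_prod[OF B0]
  proof (rule nn_integral_mono)
    fix \<tau> :: real
    have "(\<integral>\<^sup>+\<omega>. indicator B\<^sub>0 (\<omega>, \<tau>) \<partial>M) \<le> (\<integral>\<^sup>+\<omega>. indicator {..s} \<tau> \<partial>M)"
      by (intro nn_integral_mono) (auto simp: B\<^sub>0_def split: split_indicator)
    then show "(\<integral>\<^sup>+\<omega>. indicator B\<^sub>0 (\<omega>, \<tau>) \<partial>M) * indicator {0..T} \<tau> \<le> indicator {0..s} \<tau>"
      by (auto simp: emeasure_space_1 split: split_indicator split_indicator_asm)
  qed
  also have "\<dots> = ennreal s" using s by simp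
  also have "\<dots> \<le> ennreal (\<eta> / 4)" using s h by (intro ennreal_leI) simp
  finally have B0_le: "emeasure (time_prod M T) B\<^sub>0 \<le> ennreal (\<eta> / 4)" .
  have B1_le: "emeasure (time_prod M T) (B\<^sub>1 j) \<le>
      (\<integral>\<^sup>+t. indicator ({s + real j * h<..s + real (Suc j) * h} \<inter> {..T}) t * \<psi> (s + real j * h) t \<partial>lborel)" for j
    unfolding emeasure_time_prod[OF B1]
  proof (rule nn_integral_mono)
    fix \<tau> :: real
    have "(\<integral>\<^sup>+\<omega>. indicator (B\<^sub>1 j) (\<omega>, \<tau>) \<partial>M) \<le>
        (\<integral>\<^sup>+\<omega>. indicator {a j<..a (Suc j)} \<tau> * (if g' (\<omega>, a j) = g' (\<omega>, \<tau>) then 0 else 1) \<partial>M)"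
      by (intro nn_integral_mono) (auto simp: B\<^sub>1_def split: split_indicator)
    also have "\<dots> = indicator {a j<..a (Suc j)} \<tau> * \<psi> (a j) \<tau>"
      unfolding \<psi>_def by (rule nn_integral_cmult) measurable
    finally show "(\<integral>\<^sup>+\<omega>. indicator (B\<^sub>1 j) (\<omega>, \<tau>) \<partial>M) * indicator {0..T} \<tau> \<le>
        indicator ({s + real j * h<..s + real (Suc j) * h} \<inter> {..T}) \<tau> * \<psi> (s + real j * h) \<tau>"
      by (auto simp: a_def split: split_indicator split_indicator_asm)
  qed
  define B where "B = B\<^sub>0 \<union> (\<Union>j<n. B\<^sub>1 j)"
  have B: "B \<in> sets (time_prod M T)"
    unfolding B_def using B0 B1 by auto
  have "emeasure (time_prod M T) B \<le>
      emeasure (time_prod M T) B\<^sub>0 + emeasure (time_prod M T) (\<Union>j<n. B\<^sub>1 j)"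
    unfolding B_def using B0 B1 by (intro emeasure_subadditive) auto
  also have "\<dots> \<le> emeasure (time_prod M T) B\<^sub>0 + (\<Sum>j<n. emeasure (time_prod M T) (B\<^sub>1 j))"
    using B1 by (intro add_left_mono emeasure_subadditive_finite) auto
  also have "\<dots> \<le> ennreal (\<eta> / 4) + ennreal (2 * (\<eta> / 4))"
    by (intro add_mono B0_le order_trans[OF sum_mono[OF B1_le] less_imp_le[OF err]])
  also have "\<dots> = ennreal (3 * (\<eta> / 4))"
    using \<eta> by (simp flip: ennreal_plus)
  also have "\<dots> < ennreal \<eta>"
    using \<eta> by (intro ennreal_lessI) auto
  finally have B_small: "emeasure (time_prod M T) B < ennreal \<eta>" .

  have H_eq: "H \<omega> \<tau> = d (g (\<omega>, \<tau>))" if \<omega>: "\<omega> \<in> space M" and \<tau>: "\<tau> \<in> {0..T}" and nB: "(\<omega>, \<tau>) \<notin> B" for \<omega> \<tau>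
  proof -
    have sp: "(\<omega>, \<tau>) \<in> space (time_prod M T)" using \<omega> \<tau> by (simp add: space_time_prod)
    have "s < \<tau>" using nB sp by (auto simp: B_def B\<^sub>0_def)
    then obtain i where i: "i < Suc n" "t i < \<tau>" "\<tau> \<le> t (Suc i)"
      using index[of \<tau>] \<tau> s by auto
    have "i \<noteq> 0"
    proof
      assume "i = 0"
      then have "\<tau> \<le> s" using i(3) tSuc[of 0] n by (simp add: a_def)
      then show False using \<open>s < \<tau>\<close> by simp
    qed
    then obtain j where j: "i = Suc j" "j < n" using i(1) by (cases i) auto
    have "T \<le> a n" using s h by (simp add: a_def)
    then have "\<tau> \<le> a (Suc j)"
      using i(3) \<tau> j tSuc[of "Suc j"] by (cases "Suc j < n") (auto simp: not_less_eq less_Suc_eq)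
    moreover have "a j < \<tau>" using i(2) j tSuc by simp
    ultimately have "g' (\<omega>, a j) = g' (\<omega>, \<tau>)"
      using nB sp j(2) by (auto simp: B_def B\<^sub>1_def)
    moreover have "a j \<in> {0..T}" using a_pos[of j] a_less[OF j(2)] by simp
    ultimately show ?thesis
      using H_at[OF \<omega> i] g'_eq \<tau> j tSuc by metis
  qed
  show ?thesis
    by (rule that[OF H_elem B B_small H_eq H_values])
qed

section \<open>Measurability of processes and of error norms\<close>

lemma space_process_sigma [simp]: "space (process_sigma M F T) = space M \<times> {0..T}"
  by (simp add: process_sigma_def adapted_sigma_def prog_sigma_def space_measure_of_conv)

context filtered_prob_space
begin

text \<open>A progressive set is adapted: intersect it with \<open>\<Omega> \<times> [0, t]\<close> and take the section at \<open>t\<close>.\<close>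
lemma process_sigma_adapted:
  assumes "A \<in> sets (process_sigma M F T)"
  shows "A \<in> sets (time_prod M T)" and "t \<in> {0..T} \<Longrightarrow> {\<omega>. (\<omega>, t) \<in> A} \<in> sets (F t)"
proof -
  have "A \<in> sets (time_prod M T) \<and> (\<forall>t\<in>{0..T}. {\<omega>. (\<omega>, t) \<in> A} \<in> sets (F t))"
  proof (cases "usual_conditions M F T")
    case True
    then show ?thesis using assms by (simp add: process_sigma_def sets_adapted_sigma)
  next
    case False
    then have A: "A \<in> sets (time_prod M T)"
      and prog: "\<And>t. t \<in> {0..T} \<Longrightarrow>
        A \<inter> (space M \<times> {0..t}) \<in> sets (F t \<Otimes>\<^sub>M restrict_space borel {0..t})"
      using assms by (simp_all add: process_sigma_def sets_prog_sigma)
    have "{\<omega>. (\<omega>, t) \<in> A} \<in> sets (F t)" if "t \<in> {0..T}" for t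
    proof -
      have eq: "{\<omega>. (\<omega>, t) \<in> A} = (\<lambda>\<omega>. (\<omega>, t)) -` (A \<inter> (space M \<times> {0..t}))"
        using that sets.sets_into_space[OF A] by (auto simp: space_time_prod)
      show ?thesis
        unfolding eq by (rule sets_Pair2[OF prog[OF that]])
    qed
    then show ?thesis using A by simp
  qed
  then show "A \<in> sets (time_prod M T)" and "t \<in> {0..T} \<Longrightarrow> {\<omega>. (\<omega>, t) \<in> A} \<in> sets (F t)"
    by auto
qed

lemma measurable_process_sigma_time_prod:
  assumes "f \<in> process_sigma M F T \<rightarrow>\<^sub>M N"
  shows "f \<in> time_prod M T \<rightarrow>\<^sub>M N"
  using measurable_sets[OF assms] measurable_space[OF assms]
  by (intro measurableI) (auto simp: space_time_prod intro: process_sigma_adapted(1))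

lemma measurable_prog_sigmaI:
  assumes "f \<in> time_prod M T \<rightarrow>\<^sub>M N"
    and "\<And>t. t \<in> {0..T} \<Longrightarrow> f \<in> F t \<Otimes>\<^sub>M restrict_space borel {0..t} \<rightarrow>\<^sub>M N"
  shows "f \<in> prog_sigma M F T \<rightarrow>\<^sub>M N"
proof (rule measurableI)
  have sp: "space (prog_sigma M F T) = space M \<times> {0..T}"
    by (simp add: prog_sigma_def space_measure_of_conv)
  show "f x \<in> space N" if "x \<in> space (prog_sigma M F T)" for x
    using that measurable_space[OF assms(1)] by (simp add: sp space_time_prod)
  fix B assume B: "B \<in> sets N"
  have "f -` B \<inter> space (prog_sigma M F T) \<inter> (space M \<times> {0..t})
      \<in> sets (F t \<Otimes>\<^sub>M restrict_space borel {0..t})" if t: "t \<in> {0..T}" for t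
  proof -
    have "f -` B \<inter> space (prog_sigma M F T) \<inter> (space M \<times> {0..t}) =
        f -` B \<inter> space (F t \<Otimes>\<^sub>M restrict_space borel {0..t})"
      using t by (auto simp: sp space_pair_measure space_F space_restrict_space)
    then show ?thesis using measurable_sets[OF assms(2)[OF t] B] by simp
  qed
  moreover have "f -` B \<inter> space (prog_sigma M F T) \<in> sets (time_prod M T)"
    using measurable_sets[OF assms(1) B] by (simp add: sp space_time_prod)
  ultimately show "f -` B \<inter> space (prog_sigma M F T) \<in> sets (prog_sigma M F T)"
    by (simp add: sets_prog_sigma)
qed

lemma measurable_prog_sigma_time_prod:
  assumes "f \<in> prog_sigma M F T \<rightarrow>\<^sub>M N"
  shows "f \<in> time_prod M T \<rightarrow>\<^sub>M N"
proof (rule measurableI)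
  have sp: "space (prog_sigma M F T) = space (time_prod M T)"
    by (simp add: prog_sigma_def space_measure_of_conv space_time_prod)
  show "f x \<in> space N" if "x \<in> space (time_prod M T)" for x
    using measurable_space[OF assms] that sp by simp
  show "f -` B \<inter> space (time_prod M T) \<in> sets (time_prod M T)" if "B \<in> sets N" for B
    using measurable_sets[OF assms that] by (simp add: sp sets_prog_sigma)
qed

text \<open>
  At times before \<open>a\<close> the process below vanishes; from \<open>a\<close> on, the event \<open>A\<close> is known.
\<close>
lemma progressive_product:
  fixes c :: "real \<Rightarrow> real"
  assumes c: "continuous_on {0..T} c" and J: "J \<in> sets borel" and a: "a \<in> {0..T}"
    and after: "\<And>s. s \<in> J \<Longrightarrow> a \<le> s" and A: "A \<in> sets (F a)"
  shows "(\<lambda>(\<omega>, s). indicator J s * (c s * indicator A \<omega>)) \<in> borel_measurable (prog_sigma M F T)"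
proof (rule measurable_prog_sigmaI)
  have meas: "(\<lambda>(\<omega>, s). indicator J s * (c s * indicator A \<omega>)) \<in> borel_measurable (N \<Otimes>\<^sub>M R)"
    if [measurable]: "A \<in> sets N" and "sets R = sets (restrict_space borel {0..t})" and "t \<le> T"
    for N :: "'a measure" and R :: "real measure" and t
  proof -
    have "c \<in> borel_measurable (restrict_space borel {0..t})"
      using that(3) by (intro borel_measurable_continuous_on_restrict continuous_on_subset[OF c]) auto
    then have [measurable]: "c \<in> borel_measurable R"
      using measurable_cong_sets[OF that(2)] by blast
    have "(indicator J :: real \<Rightarrow> real) \<in> borel_measurable (restrict_space borel {0..t})"
      using J by (intro measurable_restrict_space1) auto
    then have [measurable]: "(indicator J :: real \<Rightarrow> real) \<in> borel_measurable R"
      using measurable_cong_sets[OF that(2)] by blast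
    show ?thesis by measurable
  qed
  have AM: "A \<in> sets M"
    using A subalgebra_F[OF a] by (auto simp: subalgebra_def)
  show "(\<lambda>(\<omega>, s). indicator J s * (c s * indicator A \<omega>)) \<in> borel_measurable (time_prod M T)"
    by (rule meas[OF AM _ order_refl]) (simp add: sets_restrict_space)
  fix t assume t: "t \<in> {0..T}"
  show "(\<lambda>(\<omega>, s). indicator J s * (c s * indicator A \<omega>)) \<in>
      borel_measurable (F t \<Otimes>\<^sub>M restrict_space borel {0..t})"
  proof (cases "a \<le> t")
    case True
    then have "A \<in> sets (F t)" using F_mono[OF a t] A by auto
    then show ?thesis using t by (intro meas) auto
  next
    case False
    then have "(\<lambda>(\<omega>, s). indicator J s * (c s * indicator A \<omega>)) \<in>
        borel_measurable (F t \<Otimes>\<^sub>M restrict_space borel {0..t}) \<longleftrightarrow>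
      (\<lambda>_. 0 :: real) \<in> borel_measurable (F t \<Otimes>\<^sub>M restrict_space borel {0..t})"
      using after
      by (intro measurable_cong) (fastforce simp: space_pair_measure space_restrict_space indicator_def)
    then show ?thesis by simp
  qed
qed

lemma elementary_process_progressive:
  fixes H :: "'a \<Rightarrow> real \<Rightarrow> 'y::metric_space \<Rightarrow> real"
  assumes H: "elementary_process M F T L H" and q: "continuous_on {0..T} q"
  shows "(\<lambda>(\<omega>, s). H \<omega> s (q s)) \<in> borel_measurable (prog_sigma M F T)"
proof -
  from H obtain n m :: nat and t :: "nat \<Rightarrow> real" and h :: "nat \<Rightarrow> nat \<Rightarrow> 'y \<Rightarrow> real"
      and A :: "nat \<Rightarrow> nat \<Rightarrow> 'a set" where E: "0 < n \<and> t 0 = 0 \<and> t n = T \<and> (\<forall>i<n. t i < t (Suc i)) \<and>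
      (\<forall>i<n. (\<forall>j<m. h i j \<in> FL L \<and> A i j \<in> sets (F (t i))) \<and>
        disjoint_family_on (A i) {..<m} \<and> (\<Union>j<m. A i j) = space M) \<and>
      (\<forall>\<omega>\<in>space M. \<forall>s\<in>{0..T}. \<forall>y.
        H \<omega> s y = indicator {0} s * (\<Sum>j<m. h 0 j y * indicator (A 0 j) \<omega>) +
          (\<Sum>i<n. indicator {t i<..t (Suc i)} s * (\<Sum>j<m. h i j y * indicator (A i j) \<omega>)))"
    unfolding elementary_process_def Let_def by (elim exE) (rule that)
  then have n: "0 < n" and t: "t 0 = 0" "t n = T" "\<And>i. i < n \<Longrightarrow> t i < t (Suc i)"
    and hA: "\<And>i j. i < n \<Longrightarrow> j < m \<Longrightarrow> h i j \<in> FL L \<and> A i j \<in> sets (F (t i))"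
    by blast+
  from E have eq: "H \<omega> s y = indicator {0} s * (\<Sum>j<m. h 0 j y * indicator (A 0 j) \<omega>) +
        (\<Sum>i<n. indicator {t i<..t (Suc i)} s * (\<Sum>j<m. h i j y * indicator (A i j) \<omega>))"
    if "\<omega> \<in> space M" "s \<in> {0..T}" for \<omega> s y
    using that by blast
  have ti: "t i \<in> {0..T}" if "i < n" for i
    using partition_mono[of n t 0 i] partition_mono[of n t i n] that t by auto
  have cont: "continuous_on {0..T} (\<lambda>s. h i j (q s))" if "i < n" "j < m" for i j
  proof -
    have "continuous_on UNIV (h i j)"
      using hA[OF that] by (auto simp: FL_def intro: lipschitz_on_continuous_on)
    then show ?thesis
      by (rule continuous_on_compose2[OF _ q]) auto
  qed
  define R where "R \<omega> s = (\<Sum>j<m. indicator {0} s * (h 0 j (q s) * indicator (A 0 j) \<omega>)) +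
      (\<Sum>i<n. \<Sum>j<m. indicator {t i<..t (Suc i)} s * (h i j (q s) * indicator (A i j) \<omega>))" for \<omega> s
  have "(\<lambda>(\<omega>, s). R \<omega> s) \<in> borel_measurable (prog_sigma M F T)"
    unfolding case_prod_beta' R_def
  proof (intro borel_measurable_add borel_measurable_sum)
    fix j assume "j \<in> {..<m}"
    then show "(\<lambda>x. indicator {0} (snd x) * (h 0 j (q (snd x)) * indicator (A 0 j) (fst x)))
        \<in> borel_measurable (prog_sigma M F T)"
      using progressive_product[of "\<lambda>s. h 0 j (q s)" "{0}" 0 "A 0 j"] cont[of 0 j] hA[of 0 j] n t ti[of 0]
      by (simp add: case_prod_beta')
  next
    fix i j assume "i \<in> {..<n}" "j \<in> {..<m}"
    then show "(\<lambda>x. indicator {t i<..t (Suc i)} (snd x) * (h i j (q (snd x)) * indicator (A i j) (fst x)))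
        \<in> borel_measurable (prog_sigma M F T)"
      using progressive_product[of "\<lambda>s. h i j (q s)" "{t i<..t (Suc i)}" "t i" "A i j"]
        cont[of i j] hA[of i j] ti[of i]
      by (simp add: case_prod_beta')
  qed
  moreover have "space (prog_sigma M F T) = space M \<times> {0..T}"
    by (simp add: prog_sigma_def space_measure_of_conv)
  moreover have "H \<omega> s (q s) = R \<omega> s" if "\<omega> \<in> space M" "s \<in> {0..T}" for \<omega> s
    unfolding R_def by (simp only: eq[OF that] sum_distrib_left)
  ultimately show ?thesis
    by (subst measurable_cong[where g = "\<lambda>(\<omega>, s). R \<omega> s"]) auto
qed

end

lemma borel_measurable_completion_null:
  fixes f g :: "'w \<Rightarrow> 'b::topological_space"
  assumes f: "f \<in> borel_measurable \<mu>" and N: "N \<in> null_sets \<mu>"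
    and eq: "\<And>x. x \<in> space \<mu> - N \<Longrightarrow> g x = f x"
  shows "g \<in> borel_measurable (completion \<mu>)"
proof (rule measurableI)
  fix B :: "'b set" assume B: "B \<in> sets borel"
  show "g -` B \<inter> space (completion \<mu>) \<in> sets (completion \<mu>)"
  proof (rule sets_completionI)
    show "g -` B \<inter> space (completion \<mu>) =
        (f -` B \<inter> space \<mu> - N) \<union> (g -` B \<inter> space \<mu> \<inter> N)"
      using eq by auto
    show "f -` B \<inter> space \<mu> - N \<in> sets \<mu>"
      using measurable_sets[OF f B] N by auto
  qed (use N in auto)
qed simp

text \<open>
  The norm after composition with \<open>Q t\<close> is lower semicontinuous in \<open>t\<close>, being a supremum of
  continuous functions.
\<close>
lemma lip_norm_comp_measurable:
  fixes Q :: "real \<Rightarrow> 'y::metric_space \<Rightarrow> 'y"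
  assumes c: "bounded_lipschitz c" and Q: "\<And>t. t \<in> {0..T} \<Longrightarrow> 1-lipschitz_on UNIV (Q t)"
    and cont: "\<And>y. continuous_on {0..T} (\<lambda>t. Q t y)"
  shows "(\<lambda>t. lip_norm (c \<circ> Q t)) \<in> borel_measurable (restrict_space lborel {0..T})"
  unfolding borel_measurable_iff_le
proof
  fix a :: real
  have "continuous_on UNIV c"
    using c by (auto simp: bounded_lipschitz_def intro: lipschitz_on_continuous_on)
  then have cQ: "continuous_on {0..T} (\<lambda>t. c (Q t y))" for y
    by (rule continuous_on_compose2[OF _ cont]) auto
  have "continuous_on {0..T} (\<lambda>t. lip_eval \<tau> (c \<circ> Q t))" for \<tau>
  proof -
    obtain x y z where "\<tau> = (x, y, z)" by (cases \<tau>) auto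
    then show ?thesis
      unfolding lip_eval_def divide_inverse by (simp, intro continuous_intros cQ)
  qed
  then have cl: "closed (\<Inter>\<tau>. {t\<in>{0..T}. lip_eval \<tau> (c \<circ> Q t) \<le> a})"
    by (intro closed_INT ballI continuous_on_closed_Collect_le continuous_intros) auto
  have "{t \<in> space (restrict_space lborel {0..T}). lip_norm (c \<circ> Q t) \<le> a} =
      (\<Inter>\<tau>. {t\<in>{0..T}. lip_eval \<tau> (c \<circ> Q t) \<le> a})"
    using lip_norm_le_iff[OF bounded_lipschitz_comp[OF c Q]] by (auto simp: space_restrict_space)
  also have "\<dots> \<in> sets (restrict_space lborel {0..T})"
    using borel_closed[OF cl] by (subst sets_restrict_space_iff) auto
  finally show "{t \<in> space (restrict_space lborel {0..T}). lip_norm (c \<circ> Q t) \<le> a}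
      \<in> sets (restrict_space lborel {0..T})" .
qed

text \<open>
  If \<open>W\<close> is almost everywhere in the closure of a countable set \<open>C\<close>, the norm of \<open>W \<circ> Q\<close> is the infimum over \<open>c \<in> C\<close> of
  \<open>lip_norm (c \<circ> Q t) + lip_norm (W - c)\<close>, and both summands are measurable.
\<close>
lemma lip_norm_process_measurable:
  fixes W :: "'a \<Rightarrow> real \<Rightarrow> 'y::metric_space \<Rightarrow> real" and Q :: "real \<Rightarrow> 'y \<Rightarrow> 'y"
  assumes W: "\<And>y. (\<lambda>(\<omega>, t). W \<omega> t y) \<in> borel_measurable (time_prod M T)"
    and bl: "\<And>\<omega> t. \<omega> \<in> space M \<Longrightarrow> t \<in> {0..T} \<Longrightarrow> bounded_lipschitz (W \<omega> t)"
    and C: "countable C" "C \<noteq> {}" "\<And>c. c \<in> C \<Longrightarrow> bounded_lipschitz c"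
    and approx: "\<And>\<omega> t \<epsilon>. (\<omega>, t) \<in> space M \<times> {0..T} - N \<Longrightarrow> 0 < \<epsilon> \<Longrightarrow>
      \<exists>c\<in>C. lip_norm (\<lambda>y. W \<omega> t y - c y) < \<epsilon>"
    and Q: "\<And>t. t \<in> {0..T} \<Longrightarrow> 1-lipschitz_on UNIV (Q t)"
    and cont: "\<And>y. continuous_on {0..T} (\<lambda>t. Q t y)"
  obtains f where "f \<in> borel_measurable (time_prod M T)"
    "\<And>\<omega> t. (\<omega>, t) \<in> space M \<times> {0..T} - N \<Longrightarrow> f (\<omega>, t) = lip_norm (W \<omega> t \<circ> Q t)"
proof -
  define D where "D = (\<lambda>(c, c') y. c y - c' y) ` (C \<times> C)"
  have D: "countable D" "\<And>d. d \<in> D \<Longrightarrow> bounded_lipschitz d"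
    using C by (auto simp: D_def intro: bounded_lipschitz_diff)
  obtain \<Theta> :: "('y \<times> 'y \<times> 'y) set" where \<Theta>: "countable \<Theta>" "\<Theta> \<noteq> {}"
    and norming: "\<And>f c. bounded_lipschitz f \<Longrightarrow>
       (\<And>\<epsilon>. 0 < \<epsilon> \<Longrightarrow> \<exists>d\<in>D. lip_norm (\<lambda>y. f y - d y) < \<epsilon>) \<Longrightarrow>
       (\<And>\<tau>. \<tau> \<in> \<Theta> \<Longrightarrow> lip_eval \<tau> f \<le> c) \<Longrightarrow> lip_norm f \<le> c"
    using countable_norming_triples[OF D] by blast
  define m where "m c x = (SUP \<tau>\<in>\<Theta>. lip_eval \<tau> (\<lambda>y. W (fst x) (snd x) y - c y))" for c x
  have Wc: "bounded_lipschitz (\<lambda>y. W \<omega> t y - c y)" if "\<omega> \<in> space M" "t \<in> {0..T}" "c \<in> C" for \<omega> t c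
    using that by (intro bounded_lipschitz_diff bl C)
  have bdd: "bdd_above ((\<lambda>\<tau>. lip_eval \<tau> (\<lambda>y. W \<omega> t y - c y)) ` \<Theta>)"
    if "\<omega> \<in> space M" "t \<in> {0..T}" "c \<in> C" for \<omega> t c
    using lip_eval_le_lip_norm[OF Wc[OF that]] by (intro bdd_aboveI2)
  have [measurable]: "(\<lambda>x. W (fst x) (snd x) y) \<in> borel_measurable (time_prod M T)" for y
    using W[of y] by (simp add: case_prod_beta')
  have m_meas: "m c \<in> borel_measurable (time_prod M T)" if "c \<in> C" for c
    unfolding m_def
  proof (rule borel_measurable_cSUP[OF \<Theta>(1)])
    fix \<tau> assume "\<tau> \<in> \<Theta>"
    obtain x y z where "\<tau> = (x, y, z)" by (cases \<tau>) auto
    then show "(\<lambda>x. lip_eval \<tau> (\<lambda>y. W (fst x) (snd x) y - c y)) \<in> borel_measurable (time_prod M T)"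
      by (simp add: lip_eval_def)
  qed (use that bdd in \<open>auto simp: space_time_prod\<close>)
  have m_nonneg: "0 \<le> m c (\<omega>, t)" if "\<omega> \<in> space M" "t \<in> {0..T}" "c \<in> C" for \<omega> t c
  proof -
    obtain \<tau> where "\<tau> \<in> \<Theta>" using \<Theta>(2) by blast
    then show ?thesis
      using cSUP_upper2[OF bdd[OF that] _ lip_eval_nonneg] by (simp add: m_def)
  qed
  have m_le: "m c (\<omega>, t) \<le> lip_norm (\<lambda>y. W \<omega> t y - c y)"
    if "\<omega> \<in> space M" "t \<in> {0..T}" "c \<in> C" for \<omega> t c
    unfolding m_def using \<Theta>(2) lip_eval_le_lip_norm[OF Wc[OF that]] by (intro cSUP_least) auto
  have m_ge: "lip_norm (\<lambda>y. W \<omega> t y - c y) \<le> m c (\<omega>, t)"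
    if x: "(\<omega>, t) \<in> space M \<times> {0..T} - N" and c: "c \<in> C" for \<omega> t c
  proof (rule norming)
    have sp: "\<omega> \<in> space M" "t \<in> {0..T}" using x by auto
    show "bounded_lipschitz (\<lambda>y. W \<omega> t y - c y)" by (rule Wc[OF sp c])
    show "lip_eval \<tau> (\<lambda>y. W \<omega> t y - c y) \<le> m c (\<omega>, t)" if "\<tau> \<in> \<Theta>" for \<tau>
      unfolding m_def using cSUP_upper[OF that bdd[OF sp c]] by simp
    fix e :: real assume "0 < e"
    then obtain c' where c': "c' \<in> C" "lip_norm (\<lambda>y. W \<omega> t y - c' y) < e"
      using approx[OF x] by blast
    then show "\<exists>d\<in>D. lip_norm (\<lambda>y. W \<omega> t y - c y - d y) < e"
      using c by (intro bexI[of _ "\<lambda>y. c' y - c y"]) (auto simp: D_def)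
  qed
  define f where "f x = (INF c\<in>C. lip_norm (c \<circ> Q (snd x)) + m c x)" for x
  have "f \<in> borel_measurable (time_prod M T)"
    unfolding f_def
  proof (rule borel_measurable_cINF_real[OF C(1)])
    fix c assume c: "c \<in> C"
    have "(\<lambda>x. lip_norm (c \<circ> Q (snd x))) \<in> borel_measurable (time_prod M T)"
      by (rule measurable_compose[OF measurable_snd lip_norm_comp_measurable[OF C(3)[OF c] Q cont]])
    then show "(\<lambda>x. lip_norm (c \<circ> Q (snd x)) + m c x) \<in> borel_measurable (time_prod M T)"
      using m_meas[OF c] by (rule borel_measurable_add)
  qed
  moreover have "f (\<omega>, t) = lip_norm (W \<omega> t \<circ> Q t)" if x: "(\<omega>, t) \<in> space M \<times> {0..T} - N" for \<omega> t
  proof (rule antisym)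
    have sp: "\<omega> \<in> space M" "t \<in> {0..T}" using x by auto
    have below: "bdd_below ((\<lambda>c. lip_norm (c \<circ> Q t) + m c (\<omega>, t)) ` C)"
      using m_nonneg[OF sp] lip_norm_nonneg[OF bounded_lipschitz_comp[OF C(3) Q[OF sp(2)]]]
      by (intro bdd_belowI2[of _ 0]) (auto intro: add_nonneg_nonneg)
    have WQ: "bounded_lipschitz (W \<omega> t \<circ> Q t)"
      by (rule bounded_lipschitz_comp[OF bl[OF sp] Q[OF sp(2)]])
    have diffQ: "lip_norm (\<lambda>y. (W \<omega> t \<circ> Q t) y - (c \<circ> Q t) y) \<le> lip_norm (\<lambda>y. W \<omega> t y - c y)" if "c \<in> C" for c
      using lip_norm_comp_le[OF Wc[OF sp that] Q[OF sp(2)]] by (simp add: comp_def)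
    show "f (\<omega>, t) \<le> lip_norm (W \<omega> t \<circ> Q t)"
    proof (rule field_le_epsilon)
      fix e :: real assume "0 < e"
      then obtain c where c: "c \<in> C" "lip_norm (\<lambda>y. W \<omega> t y - c y) < e / 2"
        using approx[OF x, of "e / 2"] by auto
      have cQ: "bounded_lipschitz (c \<circ> Q t)"
        by (rule bounded_lipschitz_comp[OF C(3)[OF c(1)] Q[OF sp(2)]])
      have "f (\<omega>, t) \<le> lip_norm (c \<circ> Q t) + m c (\<omega>, t)"
        unfolding f_def using cINF_lower[OF below c(1)] by simp
      also have "lip_norm (c \<circ> Q t) \<le>
          lip_norm (W \<omega> t \<circ> Q t) + lip_norm (\<lambda>y. (c \<circ> Q t) y - (W \<omega> t \<circ> Q t) y)"
        using lip_norm_triangle[OF WQ bounded_lipschitz_diff[OF cQ WQ]] by (simp add: comp_def)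
      also have "lip_norm (\<lambda>y. (c \<circ> Q t) y - (W \<omega> t \<circ> Q t) y) \<le> lip_norm (\<lambda>y. W \<omega> t y - c y)"
        using diffQ[OF c(1)] by (subst lip_norm_minus_commute)
      also have "m c (\<omega>, t) \<le> lip_norm (\<lambda>y. W \<omega> t y - c y)"
        by (rule m_le[OF sp c(1)])
      finally show "f (\<omega>, t) \<le> lip_norm (W \<omega> t \<circ> Q t) + e"
        using c(2) by (simp add: comp_def)
    qed
    show "lip_norm (W \<omega> t \<circ> Q t) \<le> f (\<omega>, t)"
      unfolding f_def
    proof (rule cINF_greatest[OF C(2)])
      fix c assume c: "c \<in> C"
      have cQ: "bounded_lipschitz (c \<circ> Q t)"
        by (rule bounded_lipschitz_comp[OF C(3)[OF c] Q[OF sp(2)]])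
      have "lip_norm (W \<omega> t \<circ> Q t) \<le>
          lip_norm (c \<circ> Q t) + lip_norm (\<lambda>y. (W \<omega> t \<circ> Q t) y - (c \<circ> Q t) y)"
        using lip_norm_triangle[OF cQ bounded_lipschitz_diff[OF WQ cQ]] by (simp add: comp_def)
      also have "\<dots> \<le> lip_norm (c \<circ> Q t) + m c (\<omega>, t)"
        using diffQ[OF c] m_ge[OF x c] by simp
      finally show "lip_norm (W \<omega> t \<circ> Q t) \<le> lip_norm (c \<circ> Q (snd (\<omega>, t))) + m c (\<omega>, t)"
        by simp
    qed
  qed
  ultimately show ?thesis by (rule that)
qed

section \<open>The \<open>L\<^sup>p\<close> bound\<close>

lemma (in prob_space) Lp_bound_of_small_exceptional_set:
  fixes e :: "'a \<times> real \<Rightarrow> real"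
  assumes "0 < T" and p: "1 \<le> p" and pos: "0 \<le> \<delta>" "0 \<le> R" "0 \<le> \<eta>" "0 < \<epsilon>"
    and e: "e \<in> borel_measurable (completion (time_prod M T))"
    and B: "B \<in> sets (time_prod M T)" "emeasure (time_prod M T) B \<le> ennreal \<eta>"
    and N: "N \<in> null_sets (time_prod M T)"
    and range: "\<And>x. x \<in> space (time_prod M T) - N \<Longrightarrow> 0 \<le> e x \<and> e x \<le> R"
    and small: "\<And>x. x \<in> space (time_prod M T) - N \<Longrightarrow> x \<notin> B \<Longrightarrow> e x \<le> \<delta>"
    and const: "\<delta> powr p * T + R powr p * \<eta> \<le> \<epsilon> powr p"
  shows "integrable (completion (time_prod M T)) (\<lambda>x. e x powr p)"
    and "(\<integral>x. e x powr p \<partial>completion (time_prod M T)) powr (1 / p) \<le> \<epsilon>"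
proof -
  let ?\<mu> = "time_prod M T"
  interpret finite_measure ?\<mu> by (rule finite_measure_time_prod)
  let ?b = "\<lambda>x. \<delta> powr p + R powr p * indicator B x"
  have AE_N: "AE x in completion ?\<mu>. x \<in> space ?\<mu> - N"
  proof (rule AE_completion)
    show "AE x in ?\<mu>. x \<in> space ?\<mu> - N"
      using AE_not_in[OF N] by (auto simp: eventually_conj_iff)
  qed
  have le: "e x powr p \<le> ?b x" if x: "x \<in> space ?\<mu> - N" for x
  proof (cases "x \<in> B")
    case True
    have "e x powr p \<le> R powr p"
      using range[OF x] p by (intro powr_mono2) auto
    then show ?thesis using True by (simp add: add_increasing)
  next
    case False
    have "e x powr p \<le> \<delta> powr p"
      using range[OF x] small[OF x False] p by (intro powr_mono2) auto
    then show ?thesis using False by simp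
  qed
  have b: "integrable ?\<mu> ?b"
    using B(1) by (intro Bochner_Integration.integrable_add integrable_const integrable_mult_right
        integrable_real_indicator) (auto simp: emeasure_eq_measure)
  have b_compl: "integrable (completion ?\<mu>) ?b"
    using b by (subst integrable_completion) auto
  have [measurable]: "e \<in> borel_measurable (completion ?\<mu>)" by (rule e)
  show int: "integrable (completion ?\<mu>) (\<lambda>x. e x powr p)"
  proof (rule Bochner_Integration.integrable_bound[OF b_compl])
    show "AE x in completion ?\<mu>. norm (e x powr p) \<le> norm (?b x)"
      using AE_N
    proof eventually_elim
      case (elim x)
      then show ?case using le[of x] by simp
    qed
  qed measurable
  have total: "measure ?\<mu> (space ?\<mu>) = T"
  proof -
    interpret R: finite_measure "restrict_space lborel {0..T}" by (rule finite_measure_time)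
    have "emeasure ?\<mu> (space ?\<mu>) = ennreal T"
      using \<open>0 < T\<close> emeasure_space_1 R.emeasure_pair_measure_Times[of "space M" M "{0..T}"]
      by (simp add: space_time_prod sets_restrict_space_iff emeasure_restrict_space)
    then show ?thesis using \<open>0 < T\<close> by (simp add: measure_def)
  qed
  have B_measure: "measure ?\<mu> B \<le> \<eta>"
    using B(2) pos by (simp add: emeasure_eq_measure)
  have "(\<integral>x. e x powr p \<partial>completion ?\<mu>) \<le> (\<integral>x. ?b x \<partial>completion ?\<mu>)"
  proof (rule integral_mono_AE[OF int b_compl])
    show "AE x in completion ?\<mu>. e x powr p \<le> ?b x"
      using AE_N by eventually_elim (rule le)
  qed
  also have "\<dots> = (\<integral>x. ?b x \<partial>?\<mu>)"
    using b by (intro integral_completion) auto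
  also have "\<dots> = \<delta> powr p * T + R powr p * measure ?\<mu> B"
    using B(1) total by (subst Bochner_Integration.integral_add) (auto simp: emeasure_eq_measure)
  also have "\<dots> \<le> \<delta> powr p * T + R powr p * \<eta>"
    using B_measure by (intro add_left_mono mult_left_mono) auto
  also note const
  finally have le_eps: "(\<integral>x. e x powr p \<partial>completion ?\<mu>) \<le> \<epsilon> powr p" .
  have "(\<integral>x. e x powr p \<partial>completion ?\<mu>) powr (1 / p) \<le> (\<epsilon> powr p) powr (1 / p)"
    using le_eps p by (intro powr_mono2) (auto intro: integral_nonneg_AE)
  also have "\<dots> = \<epsilon>"
    using p pos by (simp add: powr_powr)
  finally show "(\<integral>x. e x powr p \<partial>completion ?\<mu>) powr (1 / p) \<le> \<epsilon>" .
qed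

section \<open>Essentially separable range\<close>

text \<open>Either alternative hypothesis leaves a process that is almost everywhere in the closure of a countable set.\<close>
lemma (in filtered_prob_space) process_countable_approximation:
  fixes G :: "'a \<Rightarrow> real \<Rightarrow> 'y::metric_space \<Rightarrow> real"
  assumes G: "\<And>\<omega> t. \<omega> \<in> space M \<Longrightarrow> t \<in> {0..T} \<Longrightarrow> G \<omega> t \<in> FL L"
    and alt: "((\<lambda>(\<omega>, t). G \<omega> t) \<in> process_sigma M F T \<rightarrow>\<^sub>M FL_borel L \<and>
            dens_below_real_valued_measurable
              (mtopology_of (FL_metric L :: ('y \<Rightarrow> real) metric))) \<or>
         essentially_separable_range M F T L G"
  obtains C N where "countable C" "C \<subseteq> FL L" "N \<in> process_null_sets M F T"
    "\<And>\<omega> t \<epsilon>. (\<omega>, t) \<in> space M \<times> {0..T} - N \<Longrightarrow> 0 < \<epsilon> \<Longrightarrow> \<exists>c\<in>C. lip_norm (\<lambda>y. G \<omega> t y - c y) < \<epsilon>"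
proof -
  interpret FL: Metric_space "FL L :: ('y \<Rightarrow> real) set" "FL_dist L"
    by (rule Metric_space_FL)
  have top: "mtopology_of (FL_metric L) = FL.mtopology"
    by (simp add: mtopology_of_def)
  have dist: "FL_dist L f g = lip_norm (\<lambda>y. f y - g y)" if "f \<in> FL L" "g \<in> FL L" for f g :: "'y \<Rightarrow> real"
    using that by (simp add: FL_dist_def)
  from alt show ?thesis
  proof (elim disjE conjE)
    assume meas: "(\<lambda>(\<omega>, t). G \<omega> t) \<in> process_sigma M F T \<rightarrow>\<^sub>M FL_borel L"
      and small: "dens_below_real_valued_measurable
        (mtopology_of (FL_metric L :: ('y \<Rightarrow> real) metric))"
    have sets_FL: "sets (FL_borel L :: ('y \<Rightarrow> real) measure) = sigma_sets (FL L) {U. openin FL.mtopology U}"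
      unfolding FL_borel_def top using openin_subset[of FL.mtopology]
      by (intro sets_measure_of) auto
    (* Restricting the measure to the sigma-algebra of the process makes the exceptional null set
       measurable for that sigma-algebra. *)
    let ?\<mu> = "restr_to_subalg (time_prod M T) (process_sigma M F T)"
    have sub: "subalgebra (time_prod M T) (process_sigma M F T)"
      using process_sigma_adapted(1) by (auto simp: subalgebra_def space_time_prod)
    have fin: "finite_measure ?\<mu>"
      by (rule finite_measure_restr_to_subalg[OF sub finite_measure_time_prod])
    have null: "N \<in> process_null_sets M F T" if "N \<in> null_sets ?\<mu>" for N
      using that sub null_sets_restr_to_subalg[OF sub] by (auto simp: process_null_sets_def)
    obtain C N where C: "countable C" "C \<subseteq> FL L" and N: "N \<in> null_sets ?\<mu>"
      and approx: "\<And>w \<epsilon>. w \<in> space ?\<mu> - N \<Longrightarrow> 0 < \<epsilon> \<Longrightarrow> \<exists>c\<in>C. FL_dist L c ((\<lambda>(\<omega>, t). G \<omega> t) w) < \<epsilon>"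
    proof (rule FL.Borel_map_essentially_separable[OF fin, of "\<lambda>(\<omega>, t). G \<omega> t"])
      show "(\<lambda>(\<omega>, t). G \<omega> t) -` U \<inter> space ?\<mu> \<in> sets ?\<mu>" if "openin FL.mtopology U" for U
        using measurable_sets[OF meas, of U] that
        by (simp add: sets_FL sets_restr_to_subalg[OF sub] space_restr_to_subalg space_time_prod sigma_sets.Basic)
      show "(\<lambda>(\<omega>, t). G \<omega> t) w \<in> FL L" if "w \<in> space ?\<mu>" for w
        using that G by (auto simp: space_restr_to_subalg space_time_prod)
      show "dens_below_real_valued_measurable FL.mtopology"
        using small by (simp add: top)
    qed blast
    show ?thesis
    proof (rule that[OF C null[OF N]])
      fix \<omega> t and \<epsilon> :: real assume x: "(\<omega>, t) \<in> space M \<times> {0..T} - N" and "0 < \<epsilon>"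
      then obtain c where c: "c \<in> C" "FL_dist L c (G \<omega> t) < \<epsilon>"
        using approx[of "(\<omega>, t)" \<epsilon>] by (auto simp: space_restr_to_subalg space_time_prod)
      moreover have "G \<omega> t \<in> FL L" using x by (intro G) auto
      ultimately show "\<exists>c\<in>C. lip_norm (\<lambda>y. G \<omega> t y - c y) < \<epsilon>"
        using C(2) dist[of c "G \<omega> t"] lip_norm_minus_commute[of c "G \<omega> t"]
        by (intro bexI[of _ c]) auto
    qed
  next
    assume "essentially_separable_range M F T L G"
    then obtain N S where N: "N \<in> process_null_sets M F T" and S: "S \<subseteq> FL L"
      and sep: "separable_space (subtopology FL.mtopology S)"
      and GS: "\<And>\<omega> t. (\<omega>, t) \<in> space M \<times> {0..T} - N \<Longrightarrow> G \<omega> t \<in> S"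
      unfolding essentially_separable_range_def top by blast
    obtain C where C: "countable C" "C \<subseteq> S" "subtopology FL.mtopology S closure_of C = S"
      using sep S unfolding separable_space_def by (auto simp: Int_absorb1)
    show ?thesis
    proof (rule that[OF C(1) _ N])
      show "C \<subseteq> FL L" using C S by blast
      fix \<omega> t and \<epsilon> :: real assume x: "(\<omega>, t) \<in> space M \<times> {0..T} - N" and "0 < \<epsilon>"
      have "G \<omega> t \<in> FL.mtopology closure_of C"
        using GS[OF x] C(3) closure_of_subtopology[of FL.mtopology S C] C(2) by (auto simp: Int_absorb1)
      then obtain c where "c \<in> C" "c \<in> FL.mball (G \<omega> t) \<epsilon>"
        using \<open>0 < \<epsilon>\<close> by (auto simp: FL.metric_closure_of)
      then show "\<exists>c\<in>C. lip_norm (\<lambda>y. G \<omega> t y - c y) < \<epsilon>"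
        using dist[of "G \<omega> t" c] by (intro bexI[of _ c]) auto
    qed
  qed
qed

section \<open>Approximation by elementary processes\<close>

text \<open>
  Quantization: off a set of small measure, the process stays within \<open>\<delta>\<close> of a process
  with finitely many deterministic values and measurable level sets.
\<close>
lemma (in filtered_prob_space) exists_finite_quantization:
  fixes G :: "'a \<Rightarrow> real \<Rightarrow> 'y::metric_space \<Rightarrow> real" and d :: "nat \<Rightarrow> 'y \<Rightarrow> real"
  assumes G: "\<And>y. (\<lambda>(\<omega>, t). G \<omega> t y) \<in> borel_measurable (process_sigma M F T)"
    and bl: "\<And>\<omega> t. \<omega> \<in> space M \<Longrightarrow> t \<in> {0..T} \<Longrightarrow> bounded_lipschitz (G \<omega> t)"
    and d: "\<And>k. bounded_lipschitz (d k)"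
    and N: "N \<in> process_null_sets M F T"
    and approx: "\<And>\<omega> t \<epsilon>. (\<omega>, t) \<in> space M \<times> {0..T} - N \<Longrightarrow> 0 < \<epsilon> \<Longrightarrow>
      \<exists>k. lip_norm (\<lambda>y. G \<omega> t y - d k y) < \<epsilon>"
    and pos: "0 < \<delta>" "0 < \<eta>"
  obtains g :: "'a \<times> real \<Rightarrow> nat" and K B where
    "g \<in> process_sigma M F T \<rightarrow>\<^sub>M count_space UNIV" "\<And>x. g x < K"
    "B \<in> sets (time_prod M T)" "emeasure (time_prod M T) B < ennreal \<eta>"
    "\<And>\<omega> t. (\<omega>, t) \<in> space M \<times> {0..T} - N \<Longrightarrow> (\<omega>, t) \<notin> B \<Longrightarrow>
      lip_norm (\<lambda>y. G \<omega> t y - d (g (\<omega>, t)) y) \<le> \<delta>"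
proof -
  let ?P = "process_sigma M F T"
  define D where "D = range (\<lambda>(i, j) y. d i y - d j y)"
  have D_countable: "countable D"
    unfolding D_def by (rule countable_image) simp
  have D_bl: "bounded_lipschitz c" if c: "c \<in> D" for c
  proof -
    obtain i j where "c = (\<lambda>y. d i y - d j y)"
      using c by (auto simp: D_def)
    then show ?thesis using bounded_lipschitz_diff[OF d d] by simp
  qed
  obtain \<Theta> :: "('y \<times> 'y \<times> 'y) set" where \<Theta>: "countable \<Theta>" "\<Theta> \<noteq> {}"
    and norming: "\<And>f c. bounded_lipschitz f \<Longrightarrow>
       (\<And>\<epsilon>. 0 < \<epsilon> \<Longrightarrow> \<exists>d\<in>D. lip_norm (\<lambda>y. f y - d y) < \<epsilon>) \<Longrightarrow>
       (\<And>\<tau>. \<tau> \<in> \<Theta> \<Longrightarrow> lip_eval \<tau> f \<le> c) \<Longrightarrow> lip_norm f \<le> c"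
    using countable_norming_triples[OF D_countable D_bl] by blast
  define near where "near k x \<longleftrightarrow> (\<forall>\<tau>\<in>\<Theta>. lip_eval \<tau> (\<lambda>y. G (fst x) (snd x) y - d k y) \<le> \<delta>)" for k x
  have Gd: "bounded_lipschitz (\<lambda>y. G \<omega> t y - d k y)" if "\<omega> \<in> space M" "t \<in> {0..T}" for \<omega> t k
    using that by (intro bounded_lipschitz_diff bl d)
  have nearI: "near k (\<omega>, t)"
    if "\<omega> \<in> space M" "t \<in> {0..T}" "lip_norm (\<lambda>y. G \<omega> t y - d k y) \<le> \<delta>" for \<omega> t k
    using order_trans[OF lip_eval_le_lip_norm[OF Gd[OF that(1,2)]] that(3)] by (simp add: near_def)
  have nearD: "lip_norm (\<lambda>y. G \<omega> t y - d k y) \<le> \<delta>"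
    if x: "(\<omega>, t) \<in> space M \<times> {0..T} - N" and near: "near k (\<omega>, t)" for \<omega> t k
  proof (rule norming)
    show "bounded_lipschitz (\<lambda>y. G \<omega> t y - d k y)" using x by (intro Gd) auto
    show "lip_eval \<tau> (\<lambda>y. G \<omega> t y - d k y) \<le> \<delta>" if "\<tau> \<in> \<Theta>" for \<tau>
      using near that by (simp add: near_def)
    fix e :: real assume "0 < e"
    then obtain j where "lip_norm (\<lambda>y. G \<omega> t y - d j y) < e"
      using approx[OF x] by blast
    then show "\<exists>c\<in>D. lip_norm (\<lambda>y. G \<omega> t y - d k y - c y) < e"
      by (intro bexI[of _ "\<lambda>y. d j y - d k y"]) (auto simp: D_def)
  qed
  have [measurable]: "(\<lambda>x. G (fst x) (snd x) y) \<in> borel_measurable ?P" for y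
    using G[of y] by (simp add: case_prod_beta')
  have [measurable]: "(\<lambda>x. lip_eval \<tau> (\<lambda>y. G (fst x) (snd x) y - d k y)) \<in> borel_measurable ?P" for \<tau> k
  proof -
    obtain x y z where "\<tau> = (x, y, z)" by (cases \<tau>) auto
    then show ?thesis by (simp add: lip_eval_def)
  qed
  have near_meas [measurable]: "Measurable.pred ?P (near k)" for k
    unfolding near_def using \<Theta>(1) by measurable

  (* The sets far K decrease to a null set, so finitely many values suffice. *)
  define far where "far K = {x\<in>space ?P. \<forall>k<K. \<not> near k x}" for K
  have far_P: "far K \<in> sets ?P" for K
    unfolding far_def by measurable
  then have far: "far K \<in> sets (time_prod M T)" for K
    using process_sigma_adapted(1) by blast
  interpret fin: finite_measure "time_prod M T" by (rule finite_measure_time_prod)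
  have "(\<lambda>K. emeasure (time_prod M T) (far K)) \<longlonglongrightarrow> emeasure (time_prod M T) (\<Inter>K. far K)"
  proof (rule Lim_emeasure_decseq)
    show "range far \<subseteq> sets (time_prod M T)" using far by blast
    show "decseq far"
    proof (unfold decseq_def, intro allI impI subsetI)
      fix m n x assume "m \<le> n" "x \<in> far n"
      then show "x \<in> far m"
        unfolding far_def by (blast intro: less_le_trans)
    qed
    show "emeasure (time_prod M T) (far K) \<noteq> \<infinity>" for K
      using fin.emeasure_finite by simp
  qed
  moreover have "emeasure (time_prod M T) (\<Inter>K. far K) = 0"
  proof -
    have "(\<Inter>K. far K) \<subseteq> N"
    proof
      fix x assume x: "x \<in> (\<Inter>K. far K)"
      obtain \<omega> t where \<omega>t: "x = (\<omega>, t)" by (cases x)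
      have sp: "\<omega> \<in> space M" "t \<in> {0..T}" using x by (auto simp: far_def \<omega>t)
      show "x \<in> N"
      proof (rule ccontr)
        assume "x \<notin> N"
        then obtain k where "lip_norm (\<lambda>y. G \<omega> t y - d k y) < \<delta>"
          using approx[of \<omega> t \<delta>] sp pos \<omega>t by auto
        then have "near k x" unfolding \<omega>t using sp by (intro nearI) auto
        moreover have "x \<in> far (Suc k)" using x by blast
        ultimately show False by (simp add: far_def)
      qed
    qed
    moreover have "N \<in> null_sets (time_prod M T)"
      using N by (simp add: process_null_sets_def)
    ultimately show ?thesis
      by (intro emeasure_eq_0[OF null_setsD2 null_setsD1])
  qed
  ultimately have "(\<lambda>K. emeasure (time_prod M T) (far K)) \<longlonglongrightarrow> 0"
    by simp
  then have "\<forall>\<^sub>F K in sequentially. emeasure (time_prod M T) (far K) < ennreal \<eta>"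
    by (rule order_tendstoD(2)) (rule iffD2[OF ennreal_less_zero_iff pos(2)])
  then have "\<forall>\<^sub>F K in sequentially. emeasure (time_prod M T) (far K) < ennreal \<eta> \<and> 0 < K"
    using eventually_gt_at_top by (rule eventually_conj)
  then obtain K where K: "emeasure (time_prod M T) (far K) < ennreal \<eta>" "0 < K"
    using eventually_happens'[OF sequentially_bot] by blast

  define g where "g x = (if \<exists>k<K. near k x then LEAST k. near k x else 0)" for x
  show ?thesis
  proof (rule that[of g K "far K"])
    show "g \<in> ?P \<rightarrow>\<^sub>M count_space UNIV"
      unfolding g_def by measurable
    show "g x < K" for x
      using K(2) by (auto simp: g_def intro: le_less_trans[OF Least_le])
    fix \<omega> t assume x: "(\<omega>, t) \<in> space M \<times> {0..T} - N" and "(\<omega>, t) \<notin> far K"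
    then have ex: "\<exists>k<K. near k (\<omega>, t)" by (auto simp: far_def)
    then have "near (g (\<omega>, t)) (\<omega>, t)"
      unfolding g_def by (auto intro: LeastI)
    then show "lip_norm (\<lambda>y. G \<omega> t y - d (g (\<omega>, t)) y) \<le> \<delta>"
      by (rule nearD[OF x])
  qed (use far K in auto)
qed

theorem corollary4p7:
  fixes M :: "'a measure" and F :: "real \<Rightarrow> 'a measure"
    and T L p \<epsilon> :: real
    and G\<^sub>0 G :: "'a \<Rightarrow> real \<Rightarrow> 'y::metric_space \<Rightarrow> real"
    and N :: "('a \<times> real) set"
  assumes "filtered_prob_space M F T"
    and "0 < T" and "0 < L"
    and "\<exists>C. \<forall>\<omega>\<in>space M. \<forall>t\<in>{0..T}. \<forall>y. \<bar>G\<^sub>0 \<omega> t y\<bar> \<le> C"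
    and "\<And>y. (\<lambda>(\<omega>, t). G\<^sub>0 \<omega> t y) \<in> borel_measurable (process_sigma M F T)"
    and "N \<in> process_null_sets M F T"
    and "\<And>\<omega> t. (\<omega>, t) \<in> space M \<times> {0..T} - N \<Longrightarrow> G\<^sub>0 \<omega> t \<in> FL L"
    and "G = zero_on N G\<^sub>0"
    and "((\<lambda>(\<omega>, t). G \<omega> t) \<in> process_sigma M F T \<rightarrow>\<^sub>M FL_borel L \<and>
            dens_below_real_valued_measurable
              (mtopology_of (FL_metric L :: ('y \<Rightarrow> real) metric))) \<or>
         essentially_separable_range M F T L G"
    and "1 \<le> p" and "0 < \<epsilon>"
  shows "\<exists>Gbar. elementary_process M F T L Gbar \<and> Lp_error_le M T p Gbar G \<epsilon> \<and>
           (\<forall>Q :: real \<Rightarrow> 'y \<Rightarrow> 'y.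
              (\<forall>t\<in>{0..T}. nonexpansive_projection (Q t)) \<and>
              (\<forall>y. continuous_on {0..T} (\<lambda>t. Q t y)) \<and>
              (\<exists>N'\<in>process_null_sets M F T.
                 \<forall>(\<omega>, t)\<in>space M \<times> {0..T} - N'. G \<omega> t \<circ> Q t = G \<omega> t) \<longrightarrow>
              (let Ghat = (\<lambda>\<omega> t. Gbar \<omega> t \<circ> Q t) in
                 (\<forall>\<omega>\<in>space M. \<forall>t\<in>{0..T}. Ghat \<omega> t \<circ> Q t = Ghat \<omega> t) \<and>
                 (\<forall>y. (\<lambda>(\<omega>, t). Ghat \<omega> t y) \<in> borel_measurable (prog_sigma M F T)) \<and>
                 Lp_error_le M T p Ghat G \<epsilon> \<and>
                 (\<lambda>(\<omega>, t). lip_norm (\<lambda>y. Ghat \<omega> t y - G \<omega> t y))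
                   \<in> borel_measurable (completion (time_prod M T))))"
proof -
  interpret filtered_prob_space M F T by fact
  let ?\<mu> = "time_prod M T" and ?P = "process_sigma M F T"
  obtain C where C: "\<And>\<omega> t y. \<omega> \<in> space M \<Longrightarrow> t \<in> {0..T} \<Longrightarrow> \<bar>G\<^sub>0 \<omega> t y\<bar> \<le> C"
    using assms(4) by blast
  have N: "N \<in> sets ?P" using assms(6) by (simp add: process_null_sets_def)
  have G_FL: "G \<omega> t \<in> FL L" if "\<omega> \<in> space M" "t \<in> {0..T}" for \<omega> t
    using that assms(7)[of \<omega> t] assms(3) zero_in_FL[of L] by (auto simp: assms(8) zero_on_def)
  have G_bl: "bounded_lipschitz (G \<omega> t)" if "\<omega> \<in> space M" "t \<in> {0..T}" for \<omega> t
    using bounded_lipschitz_FL[OF G_FL[OF that]] .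
  have G_bound: "\<bar>G \<omega> t y\<bar> \<le> C" if "\<omega> \<in> space M" "t \<in> {0..T}" for \<omega> t y
    using C[OF that, of y] by (auto simp: assms(8) zero_on_def)
  have G_meas: "(\<lambda>(\<omega>, t). G \<omega> t y) \<in> borel_measurable ?P" for y
  proof -
    have "(\<lambda>x. if x \<in> N then 0 else (\<lambda>(\<omega>, t). G\<^sub>0 \<omega> t y) x) \<in> borel_measurable ?P"
      using N sets.Int_space_eq2[OF N] by (intro measurable_If_set measurable_const assms(5)) simp_all
    moreover have "(\<lambda>x. if x \<in> N then 0 else (\<lambda>(\<omega>, t). G\<^sub>0 \<omega> t y) x) = (\<lambda>(\<omega>, t). G \<omega> t y)"
      by (auto simp: fun_eq_iff assms(8) zero_on_def)
    ultimately show ?thesis by simp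
  qed

  define R\<^sub>0 where "R\<^sub>0 = \<bar>C\<bar> + L"
  define R where "R = R\<^sub>0 + (R\<^sub>0 + 1)"
  have R: "0 < R\<^sub>0" "0 < R" using assms(3) by (auto simp: R\<^sub>0_def R_def)
  have G_norm: "lip_norm (G \<omega> t) \<le> R\<^sub>0" if "\<omega> \<in> space M" "t \<in> {0..T}" for \<omega> t
    unfolding R\<^sub>0_def
  proof (rule lip_norm_FL_le[OF G_FL[OF that]])
    show "\<bar>G \<omega> t y\<bar> \<le> \<bar>C\<bar>" for y using G_bound[OF that, of y] by linarith
  qed
  obtain C\<^sub>0 N\<^sub>1 where C0: "countable C\<^sub>0" "C\<^sub>0 \<subseteq> FL L" and N1: "N\<^sub>1 \<in> process_null_sets M F T"
    and C0_approx: "\<And>\<omega> t \<epsilon>. (\<omega>, t) \<in> space M \<times> {0..T} - N\<^sub>1 \<Longrightarrow> 0 < \<epsilon> \<Longrightarrow>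
      \<exists>c\<in>C\<^sub>0. lip_norm (\<lambda>y. G \<omega> t y - c y) < \<epsilon>"
    using process_countable_approximation[OF G_FL assms(9)] by blast
  (* Discarding the approximants of large norm keeps the exceptional error bounded by R, a bound
     available before the number of values is chosen. *)
  define C\<^sub>1 where "C\<^sub>1 = insert (\<lambda>_. 0) {c\<in>C\<^sub>0. lip_norm c \<le> R\<^sub>0 + 1}"
  have C1: "countable C\<^sub>1" "C\<^sub>1 \<noteq> {}" "C\<^sub>1 \<subseteq> FL L"
    using C0 zero_in_FL[of L] assms(3) by (auto simp: C\<^sub>1_def)
  define d where "d = from_nat_into C\<^sub>1"
  have d_range: "range d = C\<^sub>1" using C1 by (simp add: d_def)
  have d_FL: "d k \<in> FL L" and d_norm: "lip_norm (d k) \<le> R\<^sub>0 + 1" for k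
  proof -
    have "d k \<in> C\<^sub>1" using d_range by blast
    then show "d k \<in> FL L" "lip_norm (d k) \<le> R\<^sub>0 + 1"
      using C1 R by (auto simp: C\<^sub>1_def lip_norm_zero)
  qed
  have d_bl: "bounded_lipschitz (d k)" for k by (rule bounded_lipschitz_FL[OF d_FL])
  have d_approx: "\<exists>k. lip_norm (\<lambda>y. G \<omega> t y - d k y) < e"
    if x: "(\<omega>, t) \<in> space M \<times> {0..T} - N\<^sub>1" and "0 < e" for \<omega> t e
  proof -
    obtain c where c: "c \<in> C\<^sub>0" "lip_norm (\<lambda>y. G \<omega> t y - c y) < min e 1"
      using C0_approx[OF x, of "min e 1"] \<open>0 < e\<close> by auto
    have c_bl: "bounded_lipschitz c" using c(1) C0(2) bounded_lipschitz_FL by blast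
    have sp: "\<omega> \<in> space M" "t \<in> {0..T}" using x by auto
    have "lip_norm c \<le> lip_norm (G \<omega> t) + lip_norm (\<lambda>y. c y - G \<omega> t y)"
      using lip_norm_triangle[OF G_bl[OF sp] bounded_lipschitz_diff[OF c_bl G_bl[OF sp]]] by simp
    also have "\<dots> \<le> R\<^sub>0 + 1"
      using G_norm[OF sp] c(2) lip_norm_minus_commute[of c "G \<omega> t"] by simp
    finally have "c \<in> range d" using c(1) by (simp add: d_range C\<^sub>1_def)
    then show ?thesis using c(2) by auto
  qed

  (* Each of the two terms delta^p T and R^p eta is half of epsilon^p. *)
  define \<delta> where "\<delta> = \<epsilon> * (1 / (2 * T)) powr (1 / p)"
  define \<eta> where "\<eta> = \<epsilon> powr p / (2 * R powr p)"
  have pos: "0 < \<delta>" "0 < \<eta>" using assms(2,11) R by (auto simp: \<delta>_def \<eta>_def)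
  have const: "\<delta> powr p * T + R powr p * \<eta> \<le> \<epsilon> powr p"
  proof -
    have "\<delta> powr p = \<epsilon> powr p * (1 / (2 * T))"
      using assms(2,10,11) by (simp add: \<delta>_def powr_mult powr_powr)
    then show ?thesis using assms(2) R by (simp add: \<eta>_def field_simps)
  qed
  obtain g :: "'a \<times> real \<Rightarrow> nat" and K B\<^sub>1 where g: "g \<in> ?P \<rightarrow>\<^sub>M count_space UNIV" "\<And>x. g x < K"
    and B1: "B\<^sub>1 \<in> sets ?\<mu>" "emeasure ?\<mu> B\<^sub>1 < ennreal (\<eta> / 2)"
    and g_near: "\<And>\<omega> t. (\<omega>, t) \<in> space M \<times> {0..T} - N\<^sub>1 \<Longrightarrow> (\<omega>, t) \<notin> B\<^sub>1 \<Longrightarrow>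
      lip_norm (\<lambda>y. G \<omega> t y - d (g (\<omega>, t)) y) \<le> \<delta>"
    using exists_finite_quantization[OF G_meas G_bl d_bl N1 d_approx, of \<delta> "\<eta> / 2"] pos by auto
  have g_adapted: "{\<omega>\<in>space M. g (\<omega>, t) = k} \<in> sets (F t)" if t: "t \<in> {0..T}" for t k
  proof -
    have "g -` {k} \<inter> space ?P \<in> sets ?P"
      using g(1) by (rule measurable_sets) simp
    from process_sigma_adapted(2)[OF this t] show ?thesis
      using t by (simp add: conj_commute)
  qed
  have half: "0 < \<eta> / 2" using pos by simp
  obtain H B\<^sub>2 where H: "elementary_process M F T L H"
    and B2: "B\<^sub>2 \<in> sets ?\<mu>" "emeasure ?\<mu> B\<^sub>2 < ennreal (\<eta> / 2)"
    and H_eq: "\<And>\<omega> t. \<omega> \<in> space M \<Longrightarrow> t \<in> {0..T} \<Longrightarrow> (\<omega>, t) \<notin> B\<^sub>2 \<Longrightarrow> H \<omega> t = d (g (\<omega>, t))"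
    and H_val: "\<And>\<omega> t. \<omega> \<in> space M \<Longrightarrow> t \<in> {0..T} \<Longrightarrow> \<exists>k<K. H \<omega> t = d k"
    using exists_elementary_sampling[where d = d, OF assms(2) half
        measurable_process_sigma_time_prod[OF g(1)] g(2) g_adapted d_FL] by blast
  define B where "B = B\<^sub>1 \<union> B\<^sub>2"
  have B: "B \<in> sets ?\<mu>" using B1 B2 by (simp add: B_def)
  have "emeasure ?\<mu> B \<le> emeasure ?\<mu> B\<^sub>1 + emeasure ?\<mu> B\<^sub>2"
    unfolding B_def using B1 B2 by (intro emeasure_subadditive)
  also have "\<dots> \<le> ennreal (\<eta> / 2) + ennreal (\<eta> / 2)"
    using B1 B2 by (intro add_mono) auto
  also have "\<dots> = ennreal \<eta>"
    using pos by (simp flip: ennreal_plus)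
  finally have B_small: "emeasure ?\<mu> B \<le> ennreal \<eta>" .

  define W where "W = (\<lambda>\<omega> t y. H \<omega> t y - G \<omega> t y)"
  have H_bl: "bounded_lipschitz (H \<omega> t)" if "\<omega> \<in> space M" "t \<in> {0..T}" for \<omega> t
    using H_val[OF that] d_bl by auto
  have W_bl: "bounded_lipschitz (W \<omega> t)" if "\<omega> \<in> space M" "t \<in> {0..T}" for \<omega> t
    unfolding W_def using that by (intro bounded_lipschitz_diff H_bl G_bl)
  have W_le: "lip_norm (W \<omega> t) \<le> R" if sp: "\<omega> \<in> space M" "t \<in> {0..T}" for \<omega> t
  proof -
    obtain k where "H \<omega> t = d k" using H_val[OF sp] by blast
    then have "lip_norm (H \<omega> t) \<le> R\<^sub>0 + 1" using d_norm by simp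
    then show ?thesis
      using lip_norm_diff_le[OF H_bl[OF sp] G_bl[OF sp]] G_norm[OF sp] by (simp add: W_def R_def)
  qed
  have W_small: "lip_norm (W \<omega> t) \<le> \<delta>"
    if x: "(\<omega>, t) \<in> space M \<times> {0..T} - N\<^sub>1" and nB: "(\<omega>, t) \<notin> B" for \<omega> t
    using g_near[OF x] H_eq[of \<omega> t] x nB lip_norm_minus_commute[of "d (g (\<omega>, t))" "G \<omega> t"]
    by (auto simp: B_def W_def)
  have W_meas: "(\<lambda>(\<omega>, t). W \<omega> t y) \<in> borel_measurable ?\<mu>" for y
  proof -
    have "(\<lambda>(\<omega>, s). H \<omega> s y) \<in> borel_measurable ?\<mu>"
      by (rule measurable_prog_sigma_time_prod[OF elementary_process_progressive[OF H]])
         (rule continuous_on_const)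
    moreover have "(\<lambda>(\<omega>, s). G \<omega> s y) \<in> borel_measurable ?\<mu>"
      by (rule measurable_process_sigma_time_prod[OF G_meas])
    ultimately show ?thesis
      unfolding W_def case_prod_beta' by (rule borel_measurable_diff)
  qed
  have W_approx: "\<exists>c\<in>range (\<lambda>(i, j) y. d i y - d j y). lip_norm (\<lambda>y. W \<omega> t y - c y) < e"
    if x: "(\<omega>, t) \<in> space M \<times> {0..T} - N\<^sub>1" and "0 < e" for \<omega> t e
  proof -
    obtain j where j: "lip_norm (\<lambda>y. G \<omega> t y - d j y) < e"
      using d_approx[OF x \<open>0 < e\<close>] by blast
    obtain i where i: "H \<omega> t = d i" using H_val[of \<omega> t] x by auto
    have "(\<lambda>y. W \<omega> t y - (d i y - d j y)) = (\<lambda>y. d j y - G \<omega> t y)"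
      by (simp add: W_def i)
    then have "lip_norm (\<lambda>y. W \<omega> t y - (d i y - d j y)) < e"
      using j lip_norm_minus_commute[of "d j" "G \<omega> t"] by simp
    then show ?thesis by force
  qed

  (* Stated for arbitrary Q, since the identity maps yield the bound for H itself. *)
  have stopped: "(\<lambda>(\<omega>, t). lip_norm (\<lambda>y. (H \<omega> t \<circ> Q t) y - G \<omega> t y)) \<in> borel_measurable (completion ?\<mu>) \<and>
      Lp_error_le M T p (\<lambda>\<omega> t. H \<omega> t \<circ> Q t) G \<epsilon>"
    if Q: "\<And>t. t \<in> {0..T} \<Longrightarrow> 1-lipschitz_on UNIV (Q t)" "\<And>y. continuous_on {0..T} (\<lambda>t. Q t y)"
      and N': "N' \<in> process_null_sets M F T"
      and inv: "\<And>\<omega> t. (\<omega>, t) \<in> space M \<times> {0..T} - N' \<Longrightarrow> G \<omega> t \<circ> Q t = G \<omega> t"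
    for Q :: "real \<Rightarrow> 'y \<Rightarrow> 'y" and N'
  proof -
    let ?e = "\<lambda>(\<omega>, t). lip_norm (\<lambda>y. (H \<omega> t \<circ> Q t) y - G \<omega> t y)"
    obtain f where f: "f \<in> borel_measurable ?\<mu>"
        "\<And>\<omega> t. (\<omega>, t) \<in> space M \<times> {0..T} - N\<^sub>1 \<Longrightarrow> f (\<omega>, t) = lip_norm (W \<omega> t \<circ> Q t)"
      by (rule lip_norm_process_measurable[OF W_meas W_bl _ _ _ W_approx Q])
         (auto intro: bounded_lipschitz_diff d_bl)
    have null: "N\<^sub>1 \<union> N' \<in> null_sets ?\<mu>"
      using N1 N' by (auto simp: process_null_sets_def)
    have e_eq: "?e (\<omega>, t) = lip_norm (W \<omega> t \<circ> Q t)" if "(\<omega>, t) \<in> space M \<times> {0..T} - N'" for \<omega> t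
    proof -
      have "G \<omega> t (Q t y) = G \<omega> t y" for y
        using inv[OF that] by (simp add: fun_eq_iff)
      then show ?thesis by (simp add: W_def comp_def)
    qed
    have e_meas: "?e \<in> borel_measurable (completion ?\<mu>)"
    proof (rule borel_measurable_completion_null[OF f(1) null])
      fix x assume x: "x \<in> space ?\<mu> - (N\<^sub>1 \<union> N')"
      obtain \<omega> t where "x = (\<omega>, t)" by (cases x)
      then show "?e x = f x"
        using x f(2)[of \<omega> t] e_eq[of \<omega> t] by (simp add: space_time_prod)
    qed
    have e_le: "0 \<le> ?e x \<and> ?e x \<le> R \<and> (x \<notin> B \<longrightarrow> ?e x \<le> \<delta>)" if x: "x \<in> space ?\<mu> - (N\<^sub>1 \<union> N')" for x
    proof -
      obtain \<omega> t where \<omega>t: "x = (\<omega>, t)" by (cases x)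
      have sp: "\<omega> \<in> space M" "t \<in> {0..T}" and out: "(\<omega>, t) \<in> space M \<times> {0..T} - N\<^sub>1" "(\<omega>, t) \<in> space M \<times> {0..T} - N'"
        using x by (auto simp: \<omega>t space_time_prod)
      have "?e x = lip_norm (W \<omega> t \<circ> Q t)" using e_eq[OF out(2)] \<omega>t by simp
      moreover have "0 \<le> lip_norm (W \<omega> t \<circ> Q t)"
        by (intro lip_norm_nonneg bounded_lipschitz_comp W_bl sp Q)
      moreover have "lip_norm (W \<omega> t \<circ> Q t) \<le> lip_norm (W \<omega> t)"
        by (intro lip_norm_comp_le W_bl sp Q)
      ultimately show ?thesis
        using W_le[OF sp] W_small[OF out(1)] \<omega>t by fastforce
    qed
    note bound = Lp_bound_of_small_exceptional_set[OF assms(2,10) less_imp_le[OF pos(1)]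
        less_imp_le[OF R(2)] less_imp_le[OF pos(2)] assms(11) e_meas B B_small null _ _ const]
    have "Lp_error_le M T p (\<lambda>\<omega> t. H \<omega> t \<circ> Q t) G \<epsilon>"
      unfolding Lp_error_le_def Let_def using bound e_le by (simp add: case_prod_beta')
    with e_meas show ?thesis by blast
  qed

  show ?thesis
  proof (intro exI[of _ H] conjI allI impI)
    show "elementary_process M F T L H" by (rule H)
    have "{} \<in> process_null_sets M F T" by (simp add: process_null_sets_def)
    then show "Lp_error_le M T p H G \<epsilon>"
      using stopped[of "\<lambda>_ y. y" "{}"] by (simp add: comp_def lipschitz_on_def)
    fix Q :: "real \<Rightarrow> 'y \<Rightarrow> 'y"
    assume Q: "(\<forall>t\<in>{0..T}. nonexpansive_projection (Q t)) \<and>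
        (\<forall>y. continuous_on {0..T} (\<lambda>t. Q t y)) \<and>
        (\<exists>N'\<in>process_null_sets M F T. \<forall>(\<omega>, t)\<in>space M \<times> {0..T} - N'. G \<omega> t \<circ> Q t = G \<omega> t)"
    then obtain N' where N': "N' \<in> process_null_sets M F T"
      "\<And>\<omega> t. (\<omega>, t) \<in> space M \<times> {0..T} - N' \<Longrightarrow> G \<omega> t \<circ> Q t = G \<omega> t"
      by blast
    have proj: "nonexpansive_projection (Q t)" if "t \<in> {0..T}" for t
      using Q that by blast
    have cont: "continuous_on {0..T} (\<lambda>t. Q t y)" for y
      using Q by blast
    have "1-lipschitz_on UNIV (Q t)" if "t \<in> {0..T}" for t
      using proj[OF that] by (simp add: nonexpansive_projection_def)
    note main = stopped[OF this cont N']
    have "H \<omega> t \<circ> Q t \<circ> Q t = H \<omega> t \<circ> Q t" if "t \<in> {0..T}" for \<omega> t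
      using proj[OF that] by (simp add: nonexpansive_projection_def comp_assoc)
    moreover have "(\<lambda>(\<omega>, t). (H \<omega> t \<circ> Q t) y) \<in> borel_measurable (prog_sigma M F T)" for y
      using elementary_process_progressive[OF H cont] by simp
    ultimately show "let Ghat = (\<lambda>\<omega> t. H \<omega> t \<circ> Q t) in
        (\<forall>\<omega>\<in>space M. \<forall>t\<in>{0..T}. Ghat \<omega> t \<circ> Q t = Ghat \<omega> t) \<and>
        (\<forall>y. (\<lambda>(\<omega>, t). Ghat \<omega> t y) \<in> borel_measurable (prog_sigma M F T)) \<and>
        Lp_error_le M T p Ghat G \<epsilon> \<and>
        (\<lambda>(\<omega>, t). lip_norm (\<lambda>y. Ghat \<omega> t y - G \<omega> t y)) \<in> borel_measurable (completion ?\<mu>)"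
      unfolding Let_def using main by blast
  qed
qed

end
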